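(* Let $p\in(0,1)$, $q_1=(1-\sqrt{1-p})/2$ and $q_2=1-q_1$. For $q\in(0,1)$, $\sigma>0$, $\mu\in\mathbb{R}$ put $$a_q(\sigma)=\hat\mu+\frac{\sigma\ln q}{n},\qquad \sigma_q=\frac{2m\hat\sigma}{\chi^2_q(2m-2)},\qquad b_q(\mu)=\frac{2(n(\hat\mu-\mu)+m\hat\sigma)}{\chi^2_q(2m)},\qquad \mu_q=\hat\mu-\frac{m\hat\sigma\,\mathrm{F}_q(2,2m-2)}{(m-1)n},$$ and define the confidence regions $$C_1=\{(\mu,\sigma)\in\Theta:\ a_{q_1}(\sigma)\le\mu\le a_{q_2}(\sigma),\ \sigma_{q_2}\le\sigma\le\sigma_{q_1}\},$$ $$C_2=\{(\mu,\sigma)\in\Theta:\ \mu_{q_2}\le\mu\le\mu_{q_1},\ b_{q_2}(\mu)\le\sigma\le b_{q_1}(\mu)\}.$$ Then, for $i=1,2$, the set $B_i=\bigcup_{\tilde\vartheta\in C_i}\mathrm{graph}\,F_{\tilde\vartheta}$ satisfies $$B_i=\{(x,y)\in\mathbb{R}\times[0,1]:\ U_i(x)\le y\le O_i(x)\},$$ where $$U_1(x)=\begin{cases}F_{(a_{q_2}(\sigma_{q_2}),\sigma_{q_2})}(x),&x\le\hat\mu\\ F_{(a_{q_2}(\sigma_{q_1}),\sigma_{q_1})}(x),&x>\hat\mu\end{cases},\qquad O_1(x)=\begin{cases}F_{(a_{q_1}(\sigma_{q_1}),\sigma_{q_1})}(x),&x\le\hat\mu\\ F_{(a_{q_1}(\sigma_{q_2}),\sigma_{q_2})}(x),&x>\hat\mu\end{cases},$$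 $$U_2(x)=\begin{cases}F_{(\mu_{q_1},b_{q_1}(\mu_{q_1}))}(x),&x\le\hat\mu+m\hat\sigma/n\\ F_{(\mu_{q_2},b_{q_1}(\mu_{q_2}))}(x),&x>\hat\mu+m\hat\sigma/n\end{cases},\qquad O_2(x)=\begin{cases}F_{(\mu_{q_2},b_{q_2}(\mu_{q_2}))}(x),&x\le\hat\mu+m\hat\sigma/n\\ F_{(\mu_{q_1},b_{q_2}(\mu_{q_1}))}(x),&x>\hat\mu+m\hat\sigma/n\end{cases},$$ and $B_1$, $B_2$ are confidence bands for $F_\vartheta$ with exact confidence level $1-p$.
   Context: Let $1<m\le n$ be integers and $(R_1,\dots,R_m)\in\mathbb{N}_0^m$ with $\sum_{j=1}^mR_j=n-m$; set $\gamma_j=\sum_{i=j}^m(R_i+1)$. A sample of progressively type-II censored order statistics $X=(X_{1:m:n},\dots,X_{m:m:n})$ from an absolutely continuous cdf $F$ with density $f$ has joint density $\prod_{j=1}^m\gamma_jf(x_j)[1-F(x_j)]^{R_j}$ on $x_1\le\dots\le x_m$. Here $F=F_\vartheta$ belongs to the exponential location-scale family: for $\vartheta=(\mu,\sigma)\in\Theta=\mathbb{R}\times(0,\infty)$, $F_\vartheta(x)=1-\exp\{-(x-\mu)/\sigma\}$ for $x>\mu$ and $F_\vartheta(x)=0$ for $x\le\mu$; $\vartheta$ is unknown and $P_\vartheta$ denotes the underlying probability. The MLEs are $\hat\mu=X_{1:m:n}$ and $\hat\sigma=\frac1m\sum_{j=2}^m\gamma_j(X_{j:m:n}-X_{j-1:m:n})$.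 $\chi^2_\beta(k)$ and $\mathrm{F}_\beta(k_1,k_2)$ denote the $\beta$-quantiles of the chi-square distribution with $k$ degrees of freedom and the F-distribution with $(k_1,k_2)$ degrees of freedom. $\mathrm{graph}\,F=\{(t,F(t)):t\in\mathbb{R}\}$. A confidence band is a random subset $B=B(X)$ of $\mathbb{R}^2$ such that $\{\mathrm{graph}\,F_\vartheta\subseteq B\}$ is measurable and the vertical sections $\{y:(t,y)\in B\}$ are a.s. intervals; it has exact confidence level $1-p$ if $P_\vartheta(\mathrm{graph}\,F_\vartheta\subseteq B)=1-p$ for all $\vartheta\in\Theta$. *)

theory Defs
  imports "HOL-Probability.Probability"
begin

definition expF :: "real \<Rightarrow> real \<Rightarrow> real \<Rightarrow> real" where
  "expF \<mu> \<sigma> t = (if t \<le> \<mu> then 0 else 1 - exp (-(t - \<mu>) / \<sigma>))"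

definition expf :: "real \<Rightarrow> real \<Rightarrow> real \<Rightarrow> real" where
  "expf \<mu> \<sigma> t = (if t \<le> \<mu> then 0 else exp (-(t - \<mu>) / \<sigma>) / \<sigma>)"

definition fgraph :: "(real \<Rightarrow> real) \<Rightarrow> (real \<times> real) set" where
  "fgraph F = {(t, F t) | t. True}"

definition chi2_density :: "nat \<Rightarrow> real \<Rightarrow> real" where
  "chi2_density k x = (if x \<le> 0 then 0 else
     x powr (real k / 2 - 1) * exp (- x / 2) / (2 powr (real k / 2) * Gamma (real k / 2)))"

definition F_density :: "nat \<Rightarrow> nat \<Rightarrow> real \<Rightarrow> real" where
  "F_density d1 d2 x = (if x \<le> 0 then 0 else
     (real d1 / real d2) powr (real d1 / 2) * x powr (real d1 / 2 - 1)
       * (1 + real d1 * x / real d2) powr (- (real d1 + real d2) / 2)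
       / Beta (real d1 / 2) (real d2 / 2))"

definition quantile :: "(real \<Rightarrow> real) \<Rightarrow> real \<Rightarrow> real" where
  "quantile G \<beta> = Inf {t. \<beta> \<le> G t}"

definition chi2_quantile :: "nat \<Rightarrow> real \<Rightarrow> real" where
  "chi2_quantile k \<beta> = quantile (cdf (density lborel (\<lambda>x. ennreal (chi2_density k x)))) \<beta>"

definition F_quantile :: "nat \<Rightarrow> nat \<Rightarrow> real \<Rightarrow> real" where
  "F_quantile d1 d2 \<beta> = quantile (cdf (density lborel (\<lambda>x. ennreal (F_density d1 d2 x)))) \<beta>"

section \<open>Progressively type-II censored order statistics\<close>

text \<open>Censoring scheme R_1..R_m (indices 1..m); samples x :: nat => real indexed by 1..m.\<close>

definition gam :: "nat \<Rightarrow> (nat \<Rightarrow> nat) \<Rightarrow> nat \<Rightarrow> real" where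
  "gam m R j = real (\<Sum>i\<in>{j..m}. R i + 1)"

definition pcos_density :: "nat \<Rightarrow> (nat \<Rightarrow> nat) \<Rightarrow> real \<Rightarrow> real \<Rightarrow> (nat \<Rightarrow> real) \<Rightarrow> real" where
  "pcos_density m R \<mu> \<sigma> x =
     (if (\<forall>j\<in>{1..<m}. x j \<le> x (Suc j))
      then (\<Prod>j\<in>{1..m}. gam m R j * expf \<mu> \<sigma> (x j) * (1 - expF \<mu> \<sigma> (x j)) ^ R j)
      else 0)"

definition pcos_law :: "nat \<Rightarrow> (nat \<Rightarrow> nat) \<Rightarrow> real \<Rightarrow> real \<Rightarrow> (nat \<Rightarrow> real) measure" where
  "pcos_law m R \<mu> \<sigma> =
     density (PiM {1..m} (\<lambda>_. lborel)) (\<lambda>x. ennreal (pcos_density m R \<mu> \<sigma> x))"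

definition exact_conf_band ::
  "nat \<Rightarrow> (nat \<Rightarrow> nat) \<Rightarrow> ((nat \<Rightarrow> real) \<Rightarrow> (real \<times> real) set) \<Rightarrow> real \<Rightarrow> bool" where
  "exact_conf_band m R B p \<longleftrightarrow>
     (\<forall>\<mu> \<sigma>. \<sigma> > 0 \<longrightarrow>
        {x \<in> space (pcos_law m R \<mu> \<sigma>). fgraph (expF \<mu> \<sigma>) \<subseteq> B x} \<in> sets (pcos_law m R \<mu> \<sigma>)
      \<and> (AE x in pcos_law m R \<mu> \<sigma>. \<forall>t. is_interval {y. (t, y) \<in> B x})
      \<and> measure (pcos_law m R \<mu> \<sigma>) {x \<in> space (pcos_law m R \<mu> \<sigma>). fgraph (expF \<mu> \<sigma>) \<subseteq> B x}
          = 1 - p)"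

section \<open>MLEs and the specific regions\<close>

definition muhat :: "(nat \<Rightarrow> real) \<Rightarrow> real" where
  "muhat x = x 1"

definition sighat :: "nat \<Rightarrow> (nat \<Rightarrow> nat) \<Rightarrow> (nat \<Rightarrow> real) \<Rightarrow> real" where
  "sighat m R x = (\<Sum>j\<in>{2..m}. gam m R j * (x j - x (j - 1))) / real m"

definition q1 :: "real \<Rightarrow> real" where "q1 p = (1 - sqrt (1 - p)) / 2"
definition q2 :: "real \<Rightarrow> real" where "q2 p = 1 - q1 p"

definition a_q :: "nat \<Rightarrow> (nat \<Rightarrow> real) \<Rightarrow> real \<Rightarrow> real \<Rightarrow> real" where
  "a_q n x q \<sigma> = muhat x + \<sigma> * ln q / real n"

definition sig_q :: "nat \<Rightarrow> (nat \<Rightarrow> nat) \<Rightarrow> (nat \<Rightarrow> real) \<Rightarrow> real \<Rightarrow> real" where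
  "sig_q m R x q = 2 * real m * sighat m R x / chi2_quantile (2 * m - 2) q"

definition b_q :: "nat \<Rightarrow> nat \<Rightarrow> (nat \<Rightarrow> nat) \<Rightarrow> (nat \<Rightarrow> real) \<Rightarrow> real \<Rightarrow> real \<Rightarrow> real" where
  "b_q n m R x q \<mu> = 2 * (real n * (muhat x - \<mu>) + real m * sighat m R x) / chi2_quantile (2 * m) q"

definition mu_q :: "nat \<Rightarrow> nat \<Rightarrow> (nat \<Rightarrow> nat) \<Rightarrow> (nat \<Rightarrow> real) \<Rightarrow> real \<Rightarrow> real" where
  "mu_q n m R x q = muhat x - real m * sighat m R x * F_quantile 2 (2 * m - 2) q / ((real m - 1) * real n)"

definition C1 :: "nat \<Rightarrow> nat \<Rightarrow> (nat \<Rightarrow> nat) \<Rightarrow> real \<Rightarrow> (nat \<Rightarrow> real) \<Rightarrow> (real \<times> real) set" where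
  "C1 n m R p x = {(\<mu>, \<sigma>). \<sigma> > 0 \<and>
      a_q n x (q1 p) \<sigma> \<le> \<mu> \<and> \<mu> \<le> a_q n x (q2 p) \<sigma> \<and>
      sig_q m R x (q2 p) \<le> \<sigma> \<and> \<sigma> \<le> sig_q m R x (q1 p)}"

definition C2 :: "nat \<Rightarrow> nat \<Rightarrow> (nat \<Rightarrow> nat) \<Rightarrow> real \<Rightarrow> (nat \<Rightarrow> real) \<Rightarrow> (real \<times> real) set" where
  "C2 n m R p x = {(\<mu>, \<sigma>). \<sigma> > 0 \<and>
      mu_q n m R x (q2 p) \<le> \<mu> \<and> \<mu> \<le> mu_q n m R x (q1 p) \<and>
      b_q n m R x (q2 p) \<mu> \<le> \<sigma> \<and> \<sigma> \<le> b_q n m R x (q1 p) \<mu>}"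

definition band :: "(real \<times> real) set \<Rightarrow> (real \<times> real) set" where
  "band C = (\<Union>\<theta>\<in>C. fgraph (expF (fst \<theta>) (snd \<theta>)))"

definition U1 :: "nat \<Rightarrow> nat \<Rightarrow> (nat \<Rightarrow> nat) \<Rightarrow> real \<Rightarrow> (nat \<Rightarrow> real) \<Rightarrow> real \<Rightarrow> real" where
  "U1 n m R p x t = (if t \<le> muhat x
     then expF (a_q n x (q2 p) (sig_q m R x (q2 p))) (sig_q m R x (q2 p)) t
     else expF (a_q n x (q2 p) (sig_q m R x (q1 p))) (sig_q m R x (q1 p)) t)"

definition O1 :: "nat \<Rightarrow> nat \<Rightarrow> (nat \<Rightarrow> nat) \<Rightarrow> real \<Rightarrow> (nat \<Rightarrow> real) \<Rightarrow> real \<Rightarrow> real" where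
  "O1 n m R p x t = (if t \<le> muhat x
     then expF (a_q n x (q1 p) (sig_q m R x (q1 p))) (sig_q m R x (q1 p)) t
     else expF (a_q n x (q1 p) (sig_q m R x (q2 p))) (sig_q m R x (q2 p)) t)"

definition U2 :: "nat \<Rightarrow> nat \<Rightarrow> (nat \<Rightarrow> nat) \<Rightarrow> real \<Rightarrow> (nat \<Rightarrow> real) \<Rightarrow> real \<Rightarrow> real" where
  "U2 n m R p x t = (if t \<le> muhat x + real m * sighat m R x / real n
     then expF (mu_q n m R x (q1 p)) (b_q n m R x (q1 p) (mu_q n m R x (q1 p))) t
     else expF (mu_q n m R x (q2 p)) (b_q n m R x (q1 p) (mu_q n m R x (q2 p))) t)"

definition O2 :: "nat \<Rightarrow> nat \<Rightarrow> (nat \<Rightarrow> nat) \<Rightarrow> real \<Rightarrow> (nat \<Rightarrow> real) \<Rightarrow> real \<Rightarrow> real" where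
  "O2 n m R p x t = (if t \<le> muhat x + real m * sighat m R x / real n
     then expF (mu_q n m R x (q2 p)) (b_q n m R x (q2 p) (mu_q n m R x (q2 p))) t
     else expF (mu_q n m R x (q1 p)) (b_q n m R x (q2 p) (mu_q n m R x (q1 p))) t)"

end

theory Submission
  imports Defs "HOL-Real_Asymp.Real_Asymp"
begin

text \<open>For fixed \<open>t\<close> the value \<open>F(t)\<close> is an increasing function of \<open>(t - \<mu>) / \<sigma>\<close>. In suitable coordinates this
  quotient is monotone in each parameter on a confidence region, with a direction that depends only on whether
  \<open>t\<close> lies left or right of a pivot point; so its extrema are attained at vertices of the region, which gives the
  bounding curves, and convexity of the region fills the gap between them. Evaluating the bounds at the pivot point,
  and at infinity or at the end points of the supports, shows that a graph lies in the band only if its parameter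
  lies in the region. Hence the coverage of a band equals that of its region, which is computed from the pivots:
  the normalized spacings are independent standard exponential variables, so \<open>n (\<mu>hat - \<mu>) / \<sigma>\<close> and
  \<open>m \<sigma>hat / \<sigma>\<close> are independent with exponential and Erlang distribution, and their sum and ratio are independent.\<close>

section \<open>Quantiles\<close>

text \<open>Without atoms the cdf is continuous, so the set of points where it is at least
  \<open>b\<close> is closed and contains its infimum. The intermediate value theorem gives a point
  at or below the infimum with value exactly \<open>b\<close>; it lies in the set, hence is the
  infimum.\<close>

lemma (in real_distribution) cdf_quantile:
  assumes atomless: "\<And>x. measure M {x} = 0" and "0 < b" "b < 1"
  shows "cdf M (quantile (cdf M) b) = b"
proof -
  define S where "S = {t. b \<le> cdf M t}"
  have cont: "continuous_on UNIV (cdf M)"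
    using atomless by (simp add: continuous_on_eq_continuous_at isCont_cdf)
  have "eventually (\<lambda>x. b < cdf M x) at_top"
    using order_tendstoD(1)[OF cdf_lim_at_top_prob] \<open>b < 1\<close> by blast
  then obtain u where u: "b < cdf M u"
    by (auto simp: eventually_at_top_linorder)
  have "eventually (\<lambda>x. cdf M x < b) at_bot"
    using order_tendstoD(2)[OF cdf_lim_at_bot] \<open>0 < b\<close> by blast
  then obtain l where l: "cdf M l < b"
    by (auto simp: eventually_at_bot_linorder)
  have ne: "S \<noteq> {}" using u by (auto simp: S_def intro: less_imp_le)
  have lb: "l \<le> t" if "t \<in> S" for t
    using that l cdf_nondecreasing[of t l] by (auto simp: S_def not_le intro: leI)
  then have bdd: "bdd_below S" by (auto simp: bdd_below_def)
  have "closed S"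
    unfolding S_def using cont by (intro closed_Collect_le) auto
  then have "Inf S \<in> S" using closed_contains_Inf[OF ne bdd] by simp
  then have ge: "b \<le> cdf M (Inf S)" by (simp add: S_def)
  have "l \<le> Inf S" using ne lb by (rule cInf_greatest)
  then obtain x where x: "l \<le> x" "x \<le> Inf S" "cdf M x = b"
    using IVT'[of "cdf M" l b "Inf S"] l ge continuous_on_subset[OF cont, of "{l..Inf S}"] by auto
  then have "x \<in> S" by (simp add: S_def)
  then have "x = Inf S" using cInf_lower[OF _ bdd] x(2) by (simp add: order_antisym)
  then show ?thesis using x(3) by (simp add: quantile_def S_def)
qed

text \<open>The three facts that the regions use about the quantiles of a positive continuous law. A
  density makes points null, so the closed interval has the mass of the half-open one, which is a
  difference of cdf values; positivity holds because the cdf is still 0 at the point 0.\<close>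

lemma density_quantile:
  fixes g :: "real \<Rightarrow> real"
  defines "N \<equiv> density lborel (\<lambda>x. ennreal (g x))"
  assumes [measurable]: "g \<in> borel_measurable borel" and prob: "prob_space N"
    and supp: "\<And>x. x \<le> 0 \<Longrightarrow> g x = 0" and ab: "0 < a" "a < b" "b < 1"
  shows "0 < quantile (cdf N) a" "quantile (cdf N) a < quantile (cdf N) b"
    "emeasure N {quantile (cdf N) a..quantile (cdf N) b} = ennreal (b - a)"
proof -
  interpret prob_space N by fact
  interpret real_distribution N by standard (simp add: N_def)
  have null: "emeasure N {x} = 0" for x
  proof -
    have "(\<integral>\<^sup>+y. ennreal (g y) * indicator {x} y \<partial>lborel) = 0"
      by (rule nn_integral_zero') (use AE_lborel_singleton[of x] in eventually_elim, auto)
    then show ?thesis by (simp add: N_def emeasure_density)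
  qed
  then have atomless: "measure N {x} = 0" for x by (simp add: measure_def)
  have ca: "cdf N (quantile (cdf N) a) = a" and cb: "cdf N (quantile (cdf N) b) = b"
    using cdf_quantile[OF atomless] ab by auto
  have "emeasure N {..0} = 0"
  proof -
    have "(\<integral>\<^sup>+y. ennreal (g y) * indicator {..0} y \<partial>lborel) = 0"
      by (rule nn_integral_zero') (auto simp: indicator_def supp)
    then show ?thesis by (simp add: N_def emeasure_density)
  qed
  then have c0: "cdf N 0 = 0" by (simp add: cdf_def measure_def)
  show "0 < quantile (cdf N) a"
    using cdf_nondecreasing[of "quantile (cdf N) a" 0] c0 ca ab by (auto intro: leI simp: not_le[symmetric])
  show lt: "quantile (cdf N) a < quantile (cdf N) b"
    using cdf_nondecreasing[of "quantile (cdf N) b" "quantile (cdf N) a"] ca cb ab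
    by (auto simp: not_le[symmetric])
  have "emeasure N {quantile (cdf N) a..quantile (cdf N) b}
      = emeasure N {quantile (cdf N) a<..quantile (cdf N) b}"
    using null[of "quantile (cdf N) a"] lt
    by (subst emeasure_Un_null_set[symmetric, where B="{quantile (cdf N) a}"])
       (auto intro!: arg_cong[where f="emeasure N"] simp: null_sets_def)
  also have "\<dots> = ennreal (b - a)"
    using cdf_diff_eq[OF lt] ca cb by (simp add: emeasure_eq_measure)
  finally show "emeasure N {quantile (cdf N) a..quantile (cdf N) b} = ennreal (b - a)" .
qed

section \<open>Chi-square laws with an even number of degrees of freedom as Erlang laws\<close>

lemma chi2_density_even:
  assumes "x \<noteq> 0"
  shows "chi2_density (2 * Suc k) x = erlang_density k (1/2) x"
proof (cases "x < 0")
  case False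
  with assms have x: "0 < x" by simp
  have h: "real (2 * Suc k) / 2 = real (Suc k)" by simp
  have "chi2_density (2 * Suc k) x = x powr real k * exp (- x / 2) / (2 powr real (Suc k) * Gamma (real (Suc k)))"
    using x unfolding chi2_density_def h by simp
  also have "\<dots> = x ^ k * exp (- x / 2) / (2 ^ Suc k * fact k)"
    using x Gamma_fact[of k, where 'a=real] by (simp only: powr_realpow of_nat_Suc)
      (metis powr_realpow of_nat_Suc zero_less_numeral add.commute)
  finally show ?thesis using x by (simp add: erlang_density_def power_one_over field_simps)
qed (simp add: chi2_density_def erlang_density_def)

lemma borel_measurable_chi2_density [measurable]: "chi2_density k \<in> borel_measurable borel"
  unfolding chi2_density_def[abs_def] by measurable

lemma density_chi2_even:
  "density lborel (\<lambda>x. ennreal (chi2_density (2 * Suc k) x))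
     = density lborel (\<lambda>x. ennreal (erlang_density k (1/2) x))"
proof (rule density_cong)
  show "AE x in lborel. ennreal (chi2_density (2 * Suc k) x) = ennreal (erlang_density k (1/2) x)"
    \<comment> \<open>At the point 0 the densities can disagree: for \<open>k = 0\<close> the Erlang
      density is 1/2 there, while \<open>chi2_density\<close> is 0.\<close>
    using AE_lborel_singleton[of "0::real"] by eventually_elim (subst chi2_density_even, simp_all)
qed simp_all

text \<open>Half of a chi-square variable with \<open>2 * Suc k\<close> degrees of freedom is Erlang
  with rate 1 and index \<open>k\<close>. The third claim is put in this form because the pivots
  have rate 1.\<close>

lemma chi2_quantile_even:
  assumes "0 < a" "a < b" "b < 1"
  shows "0 < chi2_quantile (2 * Suc k) a" "chi2_quantile (2 * Suc k) a < chi2_quantile (2 * Suc k) b"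
    "(\<integral>\<^sup>+x. ennreal (erlang_density k 1 x) * indicator {chi2_quantile (2 * Suc k) a..chi2_quantile (2 * Suc k) b} (2 * x) \<partial>lborel)
       = ennreal (b - a)"
proof -
  let ?N = "density lborel (\<lambda>x. ennreal (chi2_density (2 * Suc k) x))"
  have "prob_space ?N" unfolding density_chi2_even by (rule prob_space_erlang_density) simp
  note Q = density_quantile[OF borel_measurable_chi2_density this _ assms, folded chi2_quantile_def]
  show "0 < chi2_quantile (2 * Suc k) a" "chi2_quantile (2 * Suc k) a < chi2_quantile (2 * Suc k) b"
    by (rule Q, simp add: chi2_density_def)+
  let ?A = "{chi2_quantile (2 * Suc k) a..chi2_quantile (2 * Suc k) b}"
  have "ennreal (b - a) = emeasure ?N ?A"
    by (rule Q(3)[symmetric]) (simp add: chi2_density_def)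
  also have "\<dots> = (\<integral>\<^sup>+x. ennreal (erlang_density k (1/2) x) * indicator ?A x \<partial>lborel)"
    unfolding density_chi2_even by (simp add: emeasure_density)
  \<comment> \<open>Substituting \<open>2 * x\<close> for \<open>x\<close>; the factor 2 turns the
    density of rate 1/2 into that of rate 1.\<close>
  also have "\<dots> = 2 * (\<integral>\<^sup>+x. ennreal (erlang_density k (1/2) (2 * x)) * indicator ?A (2 * x) \<partial>lborel)"
    by (subst nn_integral_real_affine[where c=2 and t=0]) auto
  also have "\<dots> = (\<integral>\<^sup>+x. ennreal 2 * (ennreal (erlang_density k (1/2) (2 * x)) * indicator ?A (2 * x)) \<partial>lborel)"
    by (subst nn_integral_cmult) auto
  also have "\<dots> = (\<integral>\<^sup>+x. ennreal (erlang_density k 1 x) * indicator ?A (2 * x) \<partial>lborel)"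
    by (intro nn_integral_cong, unfold mult.assoc[symmetric], subst ennreal_mult[symmetric])
       (auto simp: erlang_density_def power_mult_distrib power_one_over)
  finally show "(\<integral>\<^sup>+x. ennreal (erlang_density k 1 x) * indicator ?A (2 * x) \<partial>lborel) = ennreal (b - a)" ..
qed

section \<open>The F-distribution with 2 and an even number of degrees of freedom\<close>

lemma borel_measurable_F_density [measurable]: "F_density d1 d2 \<in> borel_measurable borel"
  unfolding F_density_def[abs_def] by measurable

lemma Beta_1_left: "Beta 1 (real (Suc k)) = 1 / real (Suc k)"
proof -
  have "Gamma (real (Suc k)) = fact k" "Gamma (1 + real (Suc k)) = fact (Suc k)"
    using Gamma_fact[of k, where 'a=real] Gamma_fact[of "Suc k", where 'a=real]
    by (simp_all only: of_nat_Suc)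
  then show ?thesis by (simp add: Beta_def)
qed

text \<open>With 2 numerator degrees of freedom the power of \<open>x\<close> disappears, and the
  leading factor \<open>1 / Suc k\<close> cancels against the Beta value. What remains is a Lomax
  (shifted Pareto) density, which has an elementary antiderivative.\<close>

lemma F_density_2_even:
  "F_density 2 (2 * Suc k) x = (if x \<le> 0 then 0 else inverse (1 + x / real (Suc k)) ^ (k + 2))"
proof (cases "x \<le> 0")
  case False
  then have pos: "1 + x / real (Suc k) > 0" by (intro add_pos_nonneg divide_nonneg_nonneg) auto
  have h: "real (2 * Suc k) / 2 = real (Suc k)" "real 2 * x / real (2 * Suc k) = x / real (Suc k)"
    "real 2 / 2 = (1::real)" by (simp_all add: field_simps)
  have e: "- (real 2 + real (2 * Suc k)) / 2 = - real (k + 2)" by simp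
  have "F_density 2 (2 * Suc k) x
      = (2 / real (2 * Suc k)) * (1 + x / real (Suc k)) powr (- real (k + 2)) / Beta 1 (real (Suc k))"
    using False h unfolding F_density_def e h by simp
  also have "\<dots> = (1 + x / real (Suc k)) powr (- real (k + 2))"
    unfolding Beta_1_left by (simp add: field_simps)
  also have "\<dots> = inverse (1 + x / real (Suc k)) ^ (k + 2)"
    using pos by (simp only: powr_minus powr_realpow power_inverse)
  finally show ?thesis using False by simp
qed (simp add: F_density_def)

text \<open>The antiderivative is minus the survival function: it rises from -1 at 0 to 0 at
  infinity.\<close>

lemma has_real_derivative_F_2_cdf:
  assumes "0 \<le> x"
  shows "((\<lambda>x. - (inverse (1 + x / real (Suc k)) ^ Suc k))
           has_real_derivative inverse (1 + x / real (Suc k)) ^ (k + 2)) (at x)"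
proof -
  have pos: "1 + x / real (Suc k) > 0" using assms by (intro add_pos_nonneg) auto
  show ?thesis
    by (rule derivative_eq_intros refl | use pos in simp)+
qed

lemma prob_space_F_density_2:
  "prob_space (density lborel (\<lambda>x. ennreal (F_density 2 (2 * Suc k) x)))"
proof
  let ?f = "\<lambda>x. inverse (1 + x / real (Suc k)) ^ (k + 2)"
  have "(\<integral>\<^sup>+x. ennreal (F_density 2 (2 * Suc k) x) \<partial>lborel) = (\<integral>\<^sup>+x. ennreal (?f x) * indicator {0..} x \<partial>lborel)"
    by (intro nn_integral_cong_AE, use AE_lborel_singleton[of "0::real"] in eventually_elim)
       (auto simp: F_density_2_even indicator_def simp del: mult_Suc_right)
  also have "\<dots> = ennreal (0 - - (inverse (1 + 0 / real (Suc k)) ^ Suc k))"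
  proof (rule nn_integral_FTC_atLeast)
    show "((\<lambda>x. - (inverse (1 + x / real (Suc k)) ^ Suc k)) \<longlongrightarrow> 0) at_top"
    proof -
      have "((\<lambda>x. inverse (1 + x / real (Suc k))) \<longlongrightarrow> 0) at_top"
        by real_asymp
      from tendsto_minus[OF tendsto_power[OF this, of "Suc k"]] show ?thesis by simp
    qed
  qed (use has_real_derivative_F_2_cdf in auto)
  finally show "emeasure (density lborel (\<lambda>x. ennreal (F_density 2 (2 * Suc k) x)))
      (space (density lborel (\<lambda>x. ennreal (F_density 2 (2 * Suc k) x)))) = 1"
    by (simp add: emeasure_density del: mult_Suc_right)
qed

text \<open>The last claim expresses the probability between two quantiles through the survival
  function. In this form it is exactly the factor that the ratio of the pivots contributes to the
  coverage.\<close>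

lemma F_quantile_2_even:
  fixes k :: nat
  assumes "0 < a" "a < b" "b < 1"
  defines "f \<equiv> F_quantile 2 (2 * Suc k)"
  shows "0 < f a" "f a < f b"
    "inverse (1 + f a / real (Suc k)) ^ Suc k - inverse (1 + f b / real (Suc k)) ^ Suc k = b - a"
proof -
  let ?N = "density lborel (\<lambda>x. ennreal (F_density 2 (2 * Suc k) x))"
  let ?g = "\<lambda>x. inverse (1 + x / real (Suc k)) ^ (k + 2)"
  note Q = density_quantile[OF borel_measurable_F_density prob_space_F_density_2 _ assms(1-3), folded F_quantile_def, folded f_def]
  show f: "0 < f a" "f a < f b"
    unfolding f_def by (rule Q[unfolded f_def], simp add: F_density_def)+
  have "ennreal (b - a) = emeasure ?N {f a..f b}"
    unfolding f_def by (rule Q(3)[symmetric, unfolded f_def]) (simp add: F_density_def)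
  also have "\<dots> = (\<integral>\<^sup>+x. ennreal (?g x) * indicator {f a..f b} x \<partial>lborel)"
    using f by (simp add: emeasure_density del: mult_Suc_right)
      (intro nn_integral_cong, auto simp: F_density_2_even indicator_def simp del: mult_Suc_right)
  also have "\<dots> = ennreal (- (inverse (1 + f b / real (Suc k)) ^ Suc k) - - (inverse (1 + f a / real (Suc k)) ^ Suc k))"
    using f by (intro nn_integral_FTC_Icc has_real_derivative_F_2_cdf) auto
  finally have "ennreal (b - a) = \<dots>" .
  \<comment> \<open>Nonnegativity of the difference is what permits passing from equal
    \<open>ennreal\<close> values to equal reals, since \<open>ennreal\<close> sends negative
    numbers to 0.\<close>
  moreover have "inverse (1 + f b / real (Suc k)) ^ Suc k \<le> inverse (1 + f a / real (Suc k)) ^ Suc k"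
    using f by (intro power_mono le_imp_inverse_le) (auto intro!: divide_right_mono add_pos_pos)
  ultimately show "inverse (1 + f a / real (Suc k)) ^ Suc k - inverse (1 + f b / real (Suc k)) ^ Suc k = b - a"
    using assms by (simp only: minus_minus diff_minus_eq_add)
       (subst (asm) ennreal_inj, auto)
qed

section \<open>Bands of convex parameter regions\<close>

text \<open>Writing the two cases with \<open>max\<close> shows the cdf as a continuous increasing
  function of the positive part of the standardized argument, so the kink at \<open>\<mu>\<close>
  needs no separate treatment.\<close>

lemma expF_alt: "0 < \<sigma> \<Longrightarrow> expF \<mu> \<sigma> t = 1 - exp (- max 0 ((t - \<mu>) / \<sigma>))"
  by (auto simp: expF_def max_def divide_le_0_iff zero_le_divide_iff minus_divide_left[symmetric] simp del: minus_diff_eq)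

text \<open>The order of two positive parts is the order of the arguments as soon as the first one
  is positive; for \<open>t\<close> at or below \<open>\<mu>\<close> the left side is 0 and nothing
  has to be checked.\<close>

lemma expF_le_iff:
  assumes "0 < \<sigma>" "0 < \<sigma>'"
  shows "expF \<mu> \<sigma> t \<le> expF \<mu>' \<sigma>' t \<longleftrightarrow> (\<mu> < t \<longrightarrow> (t - \<mu>) / \<sigma> \<le> (t - \<mu>') / \<sigma>')"
proof -
  have "0 < (t - \<mu>) / \<sigma>" if "\<mu> < t" using that assms by simp
  moreover have "(t - \<mu>) / \<sigma> \<le> 0" if "\<not> \<mu> < t" using that assms by (simp add: divide_le_0_iff)
  ultimately show ?thesis
    using assms by (auto simp: expF_alt max_def)
qed

lemma expF_bounds: "0 < \<sigma> \<Longrightarrow> 0 \<le> expF \<mu> \<sigma> t" "0 < \<sigma> \<Longrightarrow> expF \<mu> \<sigma> t \<le> 1"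
  by (simp_all add: expF_alt)

lemma mem_band_iff: "(t, y) \<in> band C \<longleftrightarrow> (\<exists>\<theta>\<in>C. y = expF (fst \<theta>) (snd \<theta>) t)"
  by (auto simp: band_def fgraph_def)

lemma fgraph_subset_iff: "fgraph F \<subseteq> B \<longleftrightarrow> (\<forall>t. (t, F t) \<in> B)"
  by (auto simp: fgraph_def)

lemma connected_expF_image:
  assumes "convex C" and pos: "\<And>\<theta>. \<theta> \<in> C \<Longrightarrow> 0 < snd \<theta>"
  shows "connected ((\<lambda>\<theta>. expF (fst \<theta>) (snd \<theta>) t) ` C)"
proof -
  have "continuous_on C (\<lambda>\<theta>. 1 - exp (- max 0 ((t - fst \<theta>) / snd \<theta>)))"
    using pos by (intro continuous_intros) force
  also have "?this \<longleftrightarrow> continuous_on C (\<lambda>\<theta>. expF (fst \<theta>) (snd \<theta>) t)"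
    using pos by (intro continuous_on_cong) (auto simp: expF_alt)
  finally show ?thesis
    using convex_connected[OF \<open>convex C\<close>] by (rule connected_continuous_image)
qed

lemma is_interval_section_band:
  assumes "convex C" "\<And>\<theta>. \<theta> \<in> C \<Longrightarrow> 0 < snd \<theta>"
  shows "is_interval {y. (t, y) \<in> band C}"
proof -
  have "(\<lambda>\<theta>. expF (fst \<theta>) (snd \<theta>) t) ` C = {y. (t, y) \<in> band C}"
    by (auto simp: mem_band_iff)
  then show ?thesis
    using connected_expF_image[OF assms, of t] by (simp add: is_interval_connected_1)
qed

text \<open>\<open>a t\<close> and \<open>b t\<close> are parameters in \<open>C\<close> that
  minimize and maximize the cdf at \<open>t\<close>. The values attained over the convex set
  \<open>C\<close> form a connected set, so every value between these extremes is attained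
  too.\<close>

lemma band_eqI:
  assumes "convex C" and pos: "\<And>\<theta>. \<theta> \<in> C \<Longrightarrow> 0 < snd \<theta>"
    and mem: "\<And>t. a t \<in> C" "\<And>t. b t \<in> C"
    and le: "\<And>t \<theta>. \<theta> \<in> C \<Longrightarrow> expF (fst (a t)) (snd (a t)) t \<le> expF (fst \<theta>) (snd \<theta>) t"
    and ge: "\<And>t \<theta>. \<theta> \<in> C \<Longrightarrow> expF (fst \<theta>) (snd \<theta>) t \<le> expF (fst (b t)) (snd (b t)) t"
  shows "band C = {(t, y). 0 \<le> y \<and> y \<le> 1 \<and> expF (fst (a t)) (snd (a t)) t \<le> y \<and> y \<le> expF (fst (b t)) (snd (b t)) t}"
proof -
  have "(t, y) \<in> band C \<longleftrightarrow> 0 \<le> y \<and> y \<le> 1 \<and> expF (fst (a t)) (snd (a t)) t \<le> y \<and> y \<le> expF (fst (b t)) (snd (b t)) t"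
    (is "?L \<longleftrightarrow> ?R") for t y
  proof
    assume ?L
    then show ?R using le ge pos by (auto simp: mem_band_iff expF_bounds)
  next
    let ?h = "\<lambda>\<theta>. expF (fst \<theta>) (snd \<theta>) t"
    assume ?R
    have "connected (?h ` C)"
      using \<open>convex C\<close> pos by (rule connected_expF_image)
    then have "{?h (a t)..?h (b t)} \<subseteq> ?h ` C"
      using mem by (intro connected_contains_Icc) auto
    then show ?L using \<open>?R\<close> by (auto simp: mem_band_iff)
  qed
  then show ?thesis by auto
qed

lemma le_0_if_multiples_bounded:
  fixes a r :: real
  assumes "\<And>d. 0 < d \<Longrightarrow> d * a \<le> r"
  shows "a \<le> 0"
proof (rule ccontr)
  assume "\<not> a \<le> 0"
  then show False using assms[of "(\<bar>r\<bar> + 1) / a"] by (simp add: divide_pos_pos)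
qed

text \<open>The shape of \<open>C1\<close>, a trapezoid bounded by two lines through
  \<open>(h, 0)\<close> and two horizontal lines. Here \<open>h\<close> stands for the estimate of
  \<open>\<mu>\<close>, and \<open>c1\<close>, \<open>c2\<close> for the positive numbers
  \<open>- ln q / n\<close> with \<open>q\<close> equal to \<open>q2 p\<close> and
  \<open>q1 p\<close>.\<close>

definition region1 :: "real \<Rightarrow> real \<Rightarrow> real \<Rightarrow> real \<Rightarrow> real \<Rightarrow> (real \<times> real) set" where
  "region1 h c1 c2 s1 s2 = {(\<mu>, \<sigma>). 0 < \<sigma> \<and> h - \<sigma> * c2 \<le> \<mu> \<and> \<mu> \<le> h - \<sigma> * c1 \<and> s1 \<le> \<sigma> \<and> \<sigma> \<le> s2}"

lemma convex_region1: "convex (region1 h c1 c2 s1 s2)"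
proof -
  have "region1 h c1 c2 s1 s2 = {\<theta>. (0, 1) \<bullet> \<theta> > 0} \<inter> {\<theta>. (1, c2) \<bullet> \<theta> \<ge> h} \<inter> {\<theta>. (1, c1) \<bullet> \<theta> \<le> h}
      \<inter> {\<theta>. (0, 1) \<bullet> \<theta> \<ge> s1} \<inter> {\<theta>. (0, 1) \<bullet> \<theta> \<le> s2}"
    by (auto simp: region1_def inner_Pair algebra_simps)
  then show ?thesis
    by (simp only:) (intro convex_Int convex_halfspace_le convex_halfspace_ge convex_halfspace_gt)
qed

text \<open>Split \<open>(t - \<mu>) / \<sigma>\<close> as
  \<open>(t - h) / \<sigma> + (h - \<mu>) / \<sigma>\<close>. The second summand ranges over
  \<open>c1\<close> to \<open>c2\<close> whatever \<open>\<sigma>\<close> is, and the first is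
  monotone in \<open>\<sigma>\<close> with a direction given by the sign of \<open>t - h\<close>.
  The extrema are therefore taken at the four vertices.\<close>

lemma band_region1:
  assumes "0 < c1" "c1 \<le> c2" "0 < s1" "s1 \<le> s2"
  shows "band (region1 h c1 c2 s1 s2) = {(t, y). 0 \<le> y \<and> y \<le> 1 \<and>
      (if t \<le> h then expF (h - s1 * c1) s1 t else expF (h - s2 * c1) s2 t) \<le> y \<and>
      y \<le> (if t \<le> h then expF (h - s2 * c2) s2 t else expF (h - s1 * c2) s1 t)}"
    (is "_ = ?R")
proof -
  define a where "a t = (if t \<le> h then (h - s1 * c1, s1) else (h - s2 * c1, s2))" for t
  define b where "b t = (if t \<le> h then (h - s2 * c2, s2) else (h - s1 * c2, s1))" for t
  have shift: "(t - (h - s * c)) / s = (t - h) / s + c" if "0 < s" for t s c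
    using that by (simp add: field_simps)
  have rate: "(t - h) / \<sigma> + c1 \<le> (t - \<mu>) / \<sigma> \<and> (t - \<mu>) / \<sigma> \<le> (t - h) / \<sigma> + c2 \<and> 0 < \<sigma> \<and> s1 \<le> \<sigma> \<and> \<sigma> \<le> s2"
    if "(\<mu>, \<sigma>) \<in> region1 h c1 c2 s1 s2" for \<mu> \<sigma> t
  proof -
    have "(t - \<mu>) / \<sigma> = (t - h) / \<sigma> + (h - \<mu>) / \<sigma>" by (simp add: add_divide_distrib[symmetric])
    moreover have "c1 \<le> (h - \<mu>) / \<sigma>" "(h - \<mu>) / \<sigma> \<le> c2"
      using that by (auto simp: region1_def field_simps)
    ultimately show ?thesis using that by (auto simp: region1_def)
  qed
  have "band (region1 h c1 c2 s1 s2) = {(t, y). 0 \<le> y \<and> y \<le> 1 \<and> expF (fst (a t)) (snd (a t)) t \<le> y \<and> y \<le> expF (fst (b t)) (snd (b t)) t}"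
  proof (rule band_eqI)
    show "a t \<in> region1 h c1 c2 s1 s2" "b t \<in> region1 h c1 c2 s1 s2" for t
      using assms by (auto simp: a_def b_def region1_def)
  next
    fix t and \<theta> :: "real \<times> real" assume \<theta>: "\<theta> \<in> region1 h c1 c2 s1 s2"
    obtain \<mu> \<sigma> where [simp]: "\<theta> = (\<mu>, \<sigma>)" by fastforce
    note r = rate[OF \<theta>[unfolded \<open>\<theta> = _\<close>], of t]
    have "(t - h) / s1 \<le> (t - h) / \<sigma>" "(t - h) / \<sigma> \<le> (t - h) / s2" if "t \<le> h"
      using that r assms by (auto intro!: divide_left_mono_neg mult_pos_pos)
    moreover have "(t - h) / s2 \<le> (t - h) / \<sigma>" "(t - h) / \<sigma> \<le> (t - h) / s1" if "\<not> t \<le> h"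
      using that r assms by (auto intro!: divide_left_mono mult_pos_pos)
    ultimately show "expF (fst (a t)) (snd (a t)) t \<le> expF (fst \<theta>) (snd \<theta>) t"
      "expF (fst \<theta>) (snd \<theta>) t \<le> expF (fst (b t)) (snd (b t)) t"
      using r assms by (auto simp: a_def b_def expF_le_iff shift)
  qed (auto simp: convex_region1, auto simp: region1_def)
  also have "\<dots> = ?R" by (auto simp: a_def b_def)
  finally show ?thesis .
qed

text \<open>A graph inside the band could a priori be pieced together from graphs of other
  parameters. The bounds at \<open>t = h\<close> give the constraint on
  \<open>(h - \<mu>) / \<sigma>\<close>, and the bounds for large \<open>t\<close> compare the
  slopes \<open>1 / s2\<close>, \<open>1 / \<sigma>\<close> and \<open>1 / s1\<close>.\<close>

lemma fgraph_subset_band_region1_iff: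
  assumes "0 < c1" "c1 \<le> c2" "0 < s1" "s1 \<le> s2" "0 < \<sigma>"
  shows "fgraph (expF \<mu> \<sigma>) \<subseteq> band (region1 h c1 c2 s1 s2) \<longleftrightarrow> (\<mu>, \<sigma>) \<in> region1 h c1 c2 s1 s2"
proof
  assume "fgraph (expF \<mu> \<sigma>) \<subseteq> band (region1 h c1 c2 s1 s2)"
  then have *: "(if t \<le> h then expF (h - s1 * c1) s1 t else expF (h - s2 * c1) s2 t) \<le> expF \<mu> \<sigma> t"
    "expF \<mu> \<sigma> t \<le> (if t \<le> h then expF (h - s2 * c2) s2 t else expF (h - s1 * c2) s1 t)" for t
    using assms by (auto simp: fgraph_subset_iff band_region1)
  have s: "0 < s2" using assms by linarith
  have shift: "(t - (h - s * c)) / s = (t - h) / s + c" if "0 < s" for t s c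
    using that by (simp add: field_simps)
  have lo: "c1 \<le> (h - \<mu>) / \<sigma>"
    using *(1)[of h] assms by (simp add: expF_le_iff)
  \<comment> \<open>Positivity of \<open>c1\<close> places \<open>\<mu>\<close> strictly left of
    \<open>h\<close>; this makes the upper comparison informative at \<open>h\<close> and at every
    point to its right.\<close>
  then have "0 < (h - \<mu>) / \<sigma>" using assms by linarith
  then have \<mu>: "\<mu> < h" using assms by (simp add: zero_less_divide_iff)
  have hi: "(h - \<mu>) / \<sigma> \<le> c2"
    using *(2)[of h] assms \<mu> s by (simp add: expF_le_iff)
  \<comment> \<open>At \<open>t = h + d\<close> the lower bound compares two affine functions of
    \<open>d\<close>. As it holds for all positive \<open>d\<close>, the difference of slopes cannot
    be positive. The upper bound is treated in the same way afterwards.\<close>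
  have "1 / s2 - 1 / \<sigma> \<le> 0"
  proof (rule le_0_if_multiples_bounded)
    fix d :: real assume d: "0 < d"
    have "h - s2 * c1 < h" using assms s by simp
    then have "h - s2 * c1 < h + d" using d by linarith
    then have "(h + d - (h - s2 * c1)) / s2 \<le> (h + d - \<mu>) / \<sigma>"
      using *(1)[of "h + d"] d expF_le_iff[OF s \<open>0 < \<sigma>\<close>] by (metis add_le_same_cancel1 not_le)
    then have "d / s2 + c1 \<le> (h + d - \<mu>) / \<sigma>"
      using s by (simp only: shift) simp
    then show "d * (1 / s2 - 1 / \<sigma>) \<le> (h - \<mu>) / \<sigma> - c1"
      by (simp add: algebra_simps diff_divide_distrib add_divide_distrib)
  qed
  moreover have "1 / \<sigma> - 1 / s1 \<le> 0"
  proof (rule le_0_if_multiples_bounded)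
    fix d :: real assume d: "0 < d"
    have "\<mu> < h + d" using \<mu> d by linarith
    then have "(h + d - \<mu>) / \<sigma> \<le> (h + d - (h - s1 * c2)) / s1"
      using *(2)[of "h + d"] d expF_le_iff[OF \<open>0 < \<sigma>\<close> \<open>0 < s1\<close>] by (metis add_le_same_cancel1 not_le)
    then have "(h + d - \<mu>) / \<sigma> \<le> d / s1 + c2"
      using assms by (simp only: shift) simp
    then show "d * (1 / \<sigma> - 1 / s1) \<le> c2 - (h - \<mu>) / \<sigma>"
      by (simp add: algebra_simps diff_divide_distrib add_divide_distrib)
  qed
  ultimately have "s1 \<le> \<sigma>" "\<sigma> \<le> s2" using assms s by (simp_all add: field_simps)
  moreover have "h - \<sigma> * c2 \<le> \<mu>" "\<mu> \<le> h - \<sigma> * c1"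
    using lo hi assms by (simp_all add: field_simps)
  ultimately show "(\<mu>, \<sigma>) \<in> region1 h c1 c2 s1 s2" using assms by (simp add: region1_def)
qed (auto simp: band_def)

text \<open>The shape of \<open>C2\<close>. The pivot point \<open>T\<close> is the estimate of
  \<open>\<mu>\<close> plus \<open>m * sighat / n\<close>, chosen so that the numerator of
  \<open>b_q\<close> is a multiple of \<open>T - \<mu>\<close>; \<open>k1\<close> and
  \<open>k2\<close> are chi-square quantiles divided by \<open>2 * n\<close>. The indices follow the
  quantile levels, so \<open>\<mu>2\<close> is the lower end point.\<close>

definition region2 :: "real \<Rightarrow> real \<Rightarrow> real \<Rightarrow> real \<Rightarrow> real \<Rightarrow> (real \<times> real) set" where
  "region2 T k1 k2 \<mu>1 \<mu>2 = {(\<mu>, \<sigma>). 0 < \<sigma> \<and> \<mu>2 \<le> \<mu> \<and> \<mu> \<le> \<mu>1 \<and> (T - \<mu>) / k2 \<le> \<sigma> \<and> \<sigma> \<le> (T - \<mu>) / k1}"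

lemma convex_region2: "convex (region2 T k1 k2 \<mu>1 \<mu>2)"
proof -
  have "region2 T k1 k2 \<mu>1 \<mu>2 = {\<theta>. (0, 1) \<bullet> \<theta> > 0} \<inter> {\<theta>. (1, 0) \<bullet> \<theta> \<ge> \<mu>2} \<inter> {\<theta>. (1, 0) \<bullet> \<theta> \<le> \<mu>1}
      \<inter> {\<theta>. (1 / k2, 1) \<bullet> \<theta> \<ge> T / k2} \<inter> {\<theta>. (1 / k1, 1) \<bullet> \<theta> \<le> T / k1}"
    by (auto simp: region2_def inner_Pair diff_divide_distrib)
  then show ?thesis
    by (simp only:) (intro convex_Int convex_halfspace_le convex_halfspace_ge convex_halfspace_gt)
qed

text \<open>\<open>(t - c) / (T - c)\<close> equals \<open>1 + (t - T) / (T - c)\<close>, so the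
  sign of \<open>t - T\<close> decides the direction of monotonicity in \<open>c\<close>.\<close>

lemma translated_ratio_mono:
  fixes t :: real
  assumes "\<mu> \<le> \<mu>'" "\<mu>' < T"
  shows "t \<le> T \<Longrightarrow> (t - \<mu>') / (T - \<mu>') \<le> (t - \<mu>) / (T - \<mu>)"
    and "T \<le> t \<Longrightarrow> (t - \<mu>) / (T - \<mu>) \<le> (t - \<mu>') / (T - \<mu>')"
proof -
  have e: "(t - c) / (T - c) = 1 + (t - T) / (T - c)" if "c < T" for c
    using that by (simp add: field_simps)
  show "t \<le> T \<Longrightarrow> (t - \<mu>') / (T - \<mu>') \<le> (t - \<mu>) / (T - \<mu>)"
    using assms e[of \<mu>] e[of \<mu>'] by (auto intro!: divide_left_mono_neg mult_pos_pos)
  show "T \<le> t \<Longrightarrow> (t - \<mu>) / (T - \<mu>) \<le> (t - \<mu>') / (T - \<mu>')"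
    using assms e[of \<mu>] e[of \<mu>'] by (auto intro!: divide_left_mono mult_pos_pos)
qed

text \<open>With \<open>\<sigma> = (T - \<mu>) / k\<close> the standardized argument becomes
  \<open>k * (t - \<mu>) / (T - \<mu>)\<close>. For \<open>\<mu> < t\<close> it increases in
  \<open>k\<close>, and it is monotone in \<open>\<mu>\<close> in opposite directions on the two
  sides of \<open>T\<close>, so again vertices give the extrema.\<close>

lemma band_region2:
  assumes "0 < k1" "k1 \<le> k2" "\<mu>2 \<le> \<mu>1" "\<mu>1 < T"
  shows "band (region2 T k1 k2 \<mu>1 \<mu>2) = {(t, y). 0 \<le> y \<and> y \<le> 1 \<and>
      (if t \<le> T then expF \<mu>1 ((T - \<mu>1) / k1) t else expF \<mu>2 ((T - \<mu>2) / k1) t) \<le> y \<and>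
      y \<le> (if t \<le> T then expF \<mu>2 ((T - \<mu>2) / k2) t else expF \<mu>1 ((T - \<mu>1) / k2) t)}"
    (is "_ = ?R")
proof -
  define a where "a t = (if t \<le> T then (\<mu>1, (T - \<mu>1) / k1) else (\<mu>2, (T - \<mu>2) / k1))" for t
  define b where "b t = (if t \<le> T then (\<mu>2, (T - \<mu>2) / k2) else (\<mu>1, (T - \<mu>1) / k2))" for t
  have k: "0 < k1" "0 < k2" using assms by auto
  have pos: "0 < (T - \<mu>1) / k1" "0 < (T - \<mu>1) / k2" "0 < (T - \<mu>2) / k1" "0 < (T - \<mu>2) / k2"
    using assms k by auto
  have "band (region2 T k1 k2 \<mu>1 \<mu>2) = {(t, y). 0 \<le> y \<and> y \<le> 1 \<and> expF (fst (a t)) (snd (a t)) t \<le> y \<and> y \<le> expF (fst (b t)) (snd (b t)) t}"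
  proof (rule band_eqI)
    have "(T - \<mu>1) / k2 \<le> (T - \<mu>1) / k1" "(T - \<mu>2) / k2 \<le> (T - \<mu>2) / k1"
      using assms k by (auto intro!: divide_left_mono)
    then show "a t \<in> region2 T k1 k2 \<mu>1 \<mu>2" "b t \<in> region2 T k1 k2 \<mu>1 \<mu>2" for t
      using assms pos by (auto simp: a_def b_def region2_def)
  next
    fix t and \<theta> :: "real \<times> real" assume \<theta>: "\<theta> \<in> region2 T k1 k2 \<mu>1 \<mu>2"
    obtain \<mu> \<sigma> where [simp]: "\<theta> = (\<mu>, \<sigma>)" by fastforce
    have r: "0 < \<sigma>" "\<mu>2 \<le> \<mu>" "\<mu> \<le> \<mu>1" "\<mu> < T" "(T - \<mu>) / k2 \<le> \<sigma>" "\<sigma> \<le> (T - \<mu>) / k1"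
      using \<theta> assms by (auto simp: region2_def)
    have lo: "(t - \<mu>) / (T - \<mu>) * k1 \<le> (t - \<mu>) / \<sigma>" and hi: "(t - \<mu>) / \<sigma> \<le> (t - \<mu>) / (T - \<mu>) * k2"
      if "\<mu> < t"
    proof -
      have "(t - \<mu>) / ((T - \<mu>) / k1) \<le> (t - \<mu>) / \<sigma>" "(t - \<mu>) / \<sigma> \<le> (t - \<mu>) / ((T - \<mu>) / k2)"
        using that r k by (intro divide_left_mono mult_pos_pos divide_pos_pos; simp)+
      then show "(t - \<mu>) / (T - \<mu>) * k1 \<le> (t - \<mu>) / \<sigma>" "(t - \<mu>) / \<sigma> \<le> (t - \<mu>) / (T - \<mu>) * k2"
        by simp_all
    qed
    show "expF (fst (a t)) (snd (a t)) t \<le> expF (fst \<theta>) (snd \<theta>) t"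
    proof (cases "t \<le> T")
      case True
      have "(t - \<mu>1) / (T - \<mu>1) * k1 \<le> (t - \<mu>) / \<sigma>" if "\<mu>1 < t"
      proof -
        have "(t - \<mu>1) / (T - \<mu>1) * k1 \<le> (t - \<mu>) / (T - \<mu>) * k1"
          using True r assms k by (intro mult_right_mono translated_ratio_mono) auto
        also have "\<dots> \<le> (t - \<mu>) / \<sigma>" using that r by (intro lo) auto
        finally show ?thesis .
      qed
      then show ?thesis using True r pos by (simp add: a_def expF_le_iff)
    next
      case False
      have "(t - \<mu>2) / (T - \<mu>2) * k1 \<le> (t - \<mu>) / (T - \<mu>) * k1"
        using False r assms k by (intro mult_right_mono translated_ratio_mono) auto
      also have "\<dots> \<le> (t - \<mu>) / \<sigma>" using False r by (intro lo) auto
      finally show ?thesis using False r pos by (simp add: a_def expF_le_iff)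
    qed
    show "expF (fst \<theta>) (snd \<theta>) t \<le> expF (fst (b t)) (snd (b t)) t"
    proof (cases "t \<le> T")
      case True
      have "(t - \<mu>) / \<sigma> \<le> (t - \<mu>2) / (T - \<mu>2) * k2" if "\<mu> < t"
      proof -
        have "(t - \<mu>) / \<sigma> \<le> (t - \<mu>) / (T - \<mu>) * k2" using that by (rule hi)
        also have "\<dots> \<le> (t - \<mu>2) / (T - \<mu>2) * k2"
          using True r assms k by (intro mult_right_mono translated_ratio_mono) auto
        finally show ?thesis .
      qed
      then show ?thesis using True r pos by (simp add: b_def expF_le_iff)
    next
      case False
      then have "(t - \<mu>) / \<sigma> \<le> (t - \<mu>) / (T - \<mu>) * k2" using r by (intro hi) auto
      also have "\<dots> \<le> (t - \<mu>1) / (T - \<mu>1) * k2"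
        using False r assms k by (intro mult_right_mono translated_ratio_mono) auto
      finally show ?thesis using False r pos by (simp add: b_def expF_le_iff)
    qed
  qed (auto simp: convex_region2, auto simp: region2_def)
  also have "\<dots> = ?R" by (auto simp: a_def b_def)
  finally show ?thesis .
qed

text \<open>The bounds at \<open>t = T\<close> give the constraint on
  \<open>(T - \<mu>) / \<sigma>\<close>. The range of \<open>\<mu>\<close> comes from the left end
  points of the supports.\<close>

lemma fgraph_subset_band_region2_iff:
  assumes "0 < k1" "k1 \<le> k2" "\<mu>2 \<le> \<mu>1" "\<mu>1 < T" "0 < \<sigma>"
  shows "fgraph (expF \<mu> \<sigma>) \<subseteq> band (region2 T k1 k2 \<mu>1 \<mu>2) \<longleftrightarrow> (\<mu>, \<sigma>) \<in> region2 T k1 k2 \<mu>1 \<mu>2"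
proof
  assume "fgraph (expF \<mu> \<sigma>) \<subseteq> band (region2 T k1 k2 \<mu>1 \<mu>2)"
  then have *: "(if t \<le> T then expF \<mu>1 ((T - \<mu>1) / k1) t else expF \<mu>2 ((T - \<mu>2) / k1) t) \<le> expF \<mu> \<sigma> t"
    "expF \<mu> \<sigma> t \<le> (if t \<le> T then expF \<mu>2 ((T - \<mu>2) / k2) t else expF \<mu>1 ((T - \<mu>1) / k2) t)" for t
    using assms by (auto simp: fgraph_subset_iff band_region2)
  have k: "0 < k1" "0 < k2" using assms by auto
  have pos: "0 < (T - \<mu>1) / k1" "0 < (T - \<mu>1) / k2" "0 < (T - \<mu>2) / k1" "0 < (T - \<mu>2) / k2"
    using assms k by auto
  have lo: "k1 \<le> (T - \<mu>) / \<sigma>"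
    using *(1)[of T] assms pos by (simp add: expF_le_iff)
  then have "0 < (T - \<mu>) / \<sigma>" using assms by linarith
  then have \<mu>: "\<mu> < T" using assms by (simp add: zero_less_divide_iff)
  have hi: "(T - \<mu>) / \<sigma> \<le> k2"
    using *(2)[of T] assms pos \<mu> by (simp add: expF_le_iff)
  \<comment> \<open>If \<open>\<mu>\<close> exceeded \<open>\<mu>1\<close>, the lower bound would be
    positive at \<open>t = \<mu>\<close>, where the cdf itself is still 0.\<close>
  have "\<mu> \<le> \<mu>1"
  proof (rule ccontr)
    assume "\<not> \<mu> \<le> \<mu>1"
    then have "0 < (\<mu> - \<mu>1) / ((T - \<mu>1) / k1)" using assms by simp
    with \<open>\<not> \<mu> \<le> \<mu>1\<close> show False
      using *(1)[of \<mu>] \<mu> assms(5) pos by (simp add: expF_le_iff)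
  qed
  \<comment> \<open>If \<open>\<mu>\<close> were below \<open>\<mu>2\<close>, the cdf would be
    positive at \<open>t = \<mu>2\<close>, where the upper bound is still 0.\<close>
  moreover have "\<mu>2 \<le> \<mu>"
  proof (rule ccontr)
    assume "\<not> \<mu>2 \<le> \<mu>"
    have "expF \<mu> \<sigma> \<mu>2 \<le> expF \<mu>2 ((T - \<mu>2) / k2) \<mu>2"
      using *(2)[of \<mu>2] assms by simp
    then have "(\<mu>2 - \<mu>) / \<sigma> \<le> 0"
      using \<open>\<not> \<mu>2 \<le> \<mu>\<close> assms(5) pos by (simp add: expF_le_iff)
    then show False using \<open>\<not> \<mu>2 \<le> \<mu>\<close> assms by (simp add: divide_le_0_iff)
  qed
  moreover have "(T - \<mu>) / k2 \<le> \<sigma>" "\<sigma> \<le> (T - \<mu>) / k1"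
    using lo hi assms k by (simp_all add: field_simps)
  ultimately show "(\<mu>, \<sigma>) \<in> region2 T k1 k2 \<mu>1 \<mu>2" using assms by (simp add: region2_def)
qed (auto simp: band_def)

section \<open>Distribution of the pivots\<close>

lemma gam_Suc: "j \<le> m \<Longrightarrow> gam m R j = real (R j + 1) + gam m R (Suc j)"
  unfolding gam_def by (subst sum.atLeast_Suc_atMost) auto

lemma gam_pos: "j \<le> m \<Longrightarrow> 0 < gam m R j"
  by (simp add: gam_Suc) (simp add: gam_def add_pos_nonneg sum_nonneg)

lemma gam_1:
  assumes "m \<le> n" "(\<Sum>j\<in>{1..m}. R j) = n - m"
  shows "gam m R 1 = real n"
proof -
  have "(\<Sum>j\<in>{1..m}. R j + 1) = (\<Sum>j\<in>{1..m}. R j) + m" by (subst sum.distrib) simp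
  then show ?thesis using assms by (simp add: gam_def)
qed

text \<open>Since \<open>R j + 1\<close> is the difference of consecutive \<open>gam\<close> values,
  summation by parts turns the exponents into multiples of the spacings. The first observation and
  the spacings are thus independent and exponential, the first one shifted by \<open>\<mu>\<close>.
  Off the sorted samples above \<open>\<mu>\<close> both sides are 0.\<close>

lemma pcos_density_spacings:
  assumes m: "1 \<le> m" and \<sigma>: "0 < \<sigma>"
  shows "pcos_density m R \<mu> \<sigma> x = expf \<mu> (\<sigma> / gam m R 1) (x 1)
    * (\<Prod>j\<in>{2..m}. exponential_density (gam m R j / \<sigma>) (x j - x (j - 1)))"
proof (cases "(\<forall>j\<in>{1..<m}. x j \<le> x (Suc j)) \<and> \<mu> < x 1")
  case True
  then have sorted: "x j \<le> x (Suc j)" if "1 \<le> j" "j < m" for j using that by auto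
  have gt: "\<mu> < x (Suc k)" if "Suc k \<le> m" for k
    using that
  proof (induction k)
    case (Suc k)
    then show ?case using sorted[of "Suc k"] by simp
  qed (use True in simp)
  let ?P = "\<lambda>k. \<Prod>j\<in>{1..k}. gam m R j * expf \<mu> \<sigma> (x j) * (1 - expF \<mu> \<sigma> (x j)) ^ R j"
  let ?Q = "\<lambda>k. \<Prod>j\<in>{2..k}. exponential_density (gam m R j / \<sigma>) (x j - x (j - 1))"
  have factor: "gam m R (Suc k) * expf \<mu> \<sigma> (x (Suc k)) * (1 - expF \<mu> \<sigma> (x (Suc k))) ^ R (Suc k)
      = gam m R (Suc k) / \<sigma> * exp (- real (R (Suc k) + 1) * (x (Suc k) - \<mu>) / \<sigma>)"
    if "Suc k \<le> m" for k
    using gt[OF that] \<sigma>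
    by (simp add: expf_def expF_def exp_of_nat_mult[symmetric] exp_add[symmetric] field_simps)
  \<comment> \<open>The partial products match only up to a surplus exponential, as the first
    \<open>Suc k\<close> factors carry only the censoring numbers up to \<open>Suc k\<close>. At
    \<open>Suc k = m\<close> the surplus is 1, because \<open>gam\<close> is then an empty
    sum.\<close>
  have "?P (Suc k) = expf \<mu> (\<sigma> / gam m R 1) (x 1) * ?Q (Suc k) * exp (gam m R (Suc (Suc k)) * (x (Suc k) - \<mu>) / \<sigma>)"
    if "Suc k \<le> m" for k
    using that
  proof (induction k)
    case 0
    have g: "gam m R 1 = real (R 1 + 1) + gam m R 2" using gam_Suc[of 1 m R] m by (simp add: numeral_2_eq_2)
    have "?P 1 = gam m R 1 / \<sigma> * exp (- real (R 1 + 1) * (x 1 - \<mu>) / \<sigma>)"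
      using factor[of 0] 0 by simp
    also have "\<dots> = gam m R 1 / \<sigma> * (exp (- (gam m R 1 * (x 1 - \<mu>)) / \<sigma>) * exp (gam m R 2 * (x 1 - \<mu>) / \<sigma>))"
    proof -
      have "- real (R 1 + 1) * (x 1 - \<mu>) / \<sigma> = - (gam m R 1 * (x 1 - \<mu>)) / \<sigma> + gam m R 2 * (x 1 - \<mu>) / \<sigma>"
        unfolding g using \<sigma> by (simp add: field_simps)
      then show ?thesis by (simp only: exp_add)
    qed
    finally show ?case
      using gt[of 0] m \<sigma> gam_pos[of 1 m R] by (simp add: expf_def numeral_2_eq_2 field_simps)
  next
    case (Suc k)
    let ?k = "Suc k" and ?k' = "Suc (Suc k)"
    have g: "gam m R ?k' = real (R ?k' + 1) + gam m R (Suc ?k')" using gam_Suc[of ?k' m R] Suc.prems by simp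
    have d: "0 \<le> x ?k' - x ?k" using sorted[of ?k] Suc.prems by simp
    have "?P ?k' = ?P ?k * (gam m R ?k' / \<sigma> * exp (- real (R ?k' + 1) * (x ?k' - \<mu>) / \<sigma>))"
      using factor[of ?k] Suc.prems by simp
    also have "?P ?k = expf \<mu> (\<sigma> / gam m R 1) (x 1) * ?Q ?k * exp (gam m R ?k' * (x ?k - \<mu>) / \<sigma>)"
      using Suc by simp
    also have "expf \<mu> (\<sigma> / gam m R 1) (x 1) * ?Q ?k * exp (gam m R ?k' * (x ?k - \<mu>) / \<sigma>)
        * (gam m R ?k' / \<sigma> * exp (- real (R ?k' + 1) * (x ?k' - \<mu>) / \<sigma>))
      = expf \<mu> (\<sigma> / gam m R 1) (x 1) * ?Q ?k * (gam m R ?k' / \<sigma>)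
        * exp (gam m R ?k' * (x ?k - \<mu>) / \<sigma> + - real (R ?k' + 1) * (x ?k' - \<mu>) / \<sigma>)"
      unfolding exp_add by simp
    also have "gam m R ?k' * (x ?k - \<mu>) / \<sigma> + - real (R ?k' + 1) * (x ?k' - \<mu>) / \<sigma>
      = - (x ?k' - x ?k) * (gam m R ?k' / \<sigma>) + gam m R (Suc ?k') * (x ?k' - \<mu>) / \<sigma>"
      unfolding g using \<sigma> by (simp add: field_simps)
    also have "expf \<mu> (\<sigma> / gam m R 1) (x 1) * ?Q ?k * (gam m R ?k' / \<sigma>) * exp \<dots>
      = expf \<mu> (\<sigma> / gam m R 1) (x 1) * (?Q ?k * exponential_density (gam m R ?k' / \<sigma>) (x ?k' - x ?k))
        * exp (gam m R (Suc ?k') * (x ?k' - \<mu>) / \<sigma>)"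
      unfolding exp_add using d by (simp add: exponential_density_def)
    also have "?Q ?k * exponential_density (gam m R ?k' / \<sigma>) (x ?k' - x ?k) = ?Q ?k'"
      by (simp add: prod.nat_ivl_Suc' mult.commute)
    finally show ?case .
  qed
  from this[of "m - 1"] have "?P m = expf \<mu> (\<sigma> / gam m R 1) (x 1) * ?Q m"
    using m by (simp add: gam_def)
  then show ?thesis using True by (simp add: pcos_density_def)
next
  case False
  show ?thesis
  proof (cases "\<forall>j\<in>{1..<m}. x j \<le> x (Suc j)")
    case True
    then have "x 1 \<le> \<mu>" using False by auto
    then have "expf \<mu> c (x 1) = 0" for c by (simp add: expf_def)
    moreover from this have "(\<Prod>j\<in>{1..m}. gam m R j * expf \<mu> \<sigma> (x j) * (1 - expF \<mu> \<sigma> (x j)) ^ R j) = 0"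
      using m by (intro prod_zero bexI[of _ 1]) auto
    ultimately show ?thesis by (simp add: pcos_density_def)
  next
    case unsorted: False
    then obtain j where j: "1 \<le> j" "j < m" "x (Suc j) < x j" by (auto simp: not_le)
    then have "(\<Prod>j\<in>{2..m}. exponential_density (gam m R j / \<sigma>) (x j - x (j - 1))) = 0"
      by (intro prod_zero bexI[of _ "Suc j"]) (auto simp: exponential_density_def)
    then show ?thesis using unsorted by (simp only: pcos_density_def if_False mult_zero_right)
  qed
qed

section \<open>Integrating out the normalized spacings\<close>

lemma nn_integral_exponential_shift:
  fixes g :: "real \<Rightarrow> ennreal"
  assumes [measurable]: "g \<in> borel_measurable borel" and l: "0 < l"
  shows "(\<integral>\<^sup>+y. ennreal (exponential_density l (y - a)) * g (s + l * (y - a)) \<partial>lborel)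
    = (\<integral>\<^sup>+v. ennreal (exponential_density 1 v) * g (s + v) \<partial>lborel)"
proof -
  have "(\<integral>\<^sup>+y. ennreal (exponential_density l (y - a)) * g (s + l * (y - a)) \<partial>lborel)
    = ennreal (1 / l) * (\<integral>\<^sup>+v. ennreal (exponential_density l (v / l)) * g (s + v) \<partial>lborel)"
    \<comment> \<open>Substitution \<open>v = l * (y - a)\<close>: the spacing is normalized to a
      standard exponential variable.\<close>
    using l by (subst nn_integral_real_affine[where c="1 / l" and t=a]) auto
  also have "\<dots> = (\<integral>\<^sup>+v. ennreal (1 / l) * (ennreal (exponential_density l (v / l)) * g (s + v)) \<partial>lborel)"
    by (subst nn_integral_cmult) auto
  also have "\<dots> = (\<integral>\<^sup>+v. ennreal (exponential_density 1 v) * g (s + v) \<partial>lborel)"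
    using l by (intro nn_integral_cong, unfold mult.assoc[symmetric], subst ennreal_mult[symmetric])
      (auto simp: exponential_density_def divide_less_0_iff)
  finally show ?thesis .
qed

text \<open>Adding an independent standard exponential to an Erlang variable raises its index by
  one. After the substitution \<open>w = s + v\<close> and Fubini the inner integral is the
  convolution of the two densities.\<close>

lemma nn_integral_erlang_convolution:
  fixes g :: "real \<Rightarrow> ennreal"
  assumes [measurable]: "g \<in> borel_measurable borel"
  shows "(\<integral>\<^sup>+s. ennreal (erlang_density i 1 s) * (\<integral>\<^sup>+v. ennreal (exponential_density 1 v) * g (s + v) \<partial>lborel) \<partial>lborel)
    = (\<integral>\<^sup>+w. ennreal (erlang_density (Suc i) 1 w) * g w \<partial>lborel)"
proof -
  have "(\<integral>\<^sup>+s. ennreal (erlang_density i 1 s) * (\<integral>\<^sup>+v. ennreal (exponential_density 1 v) * g (s + v) \<partial>lborel) \<partial>lborel)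
    = (\<integral>\<^sup>+s. (\<integral>\<^sup>+w. ennreal (exponential_density 1 (w - s)) * ennreal (erlang_density i 1 s) * g w \<partial>lborel) \<partial>lborel)"
  proof (rule nn_integral_cong)
    fix s
    have "(\<integral>\<^sup>+v. ennreal (exponential_density 1 v) * g (s + v) \<partial>lborel)
      = (\<integral>\<^sup>+w. ennreal (exponential_density 1 (w - s)) * g w \<partial>lborel)"
      by (subst nn_integral_real_affine[where c=1 and t="- s"]) auto
    then show "ennreal (erlang_density i 1 s) * (\<integral>\<^sup>+v. ennreal (exponential_density 1 v) * g (s + v) \<partial>lborel)
      = (\<integral>\<^sup>+w. ennreal (exponential_density 1 (w - s)) * ennreal (erlang_density i 1 s) * g w \<partial>lborel)"
      by (simp add: nn_integral_cmult[symmetric] ac_simps)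
  qed
  also have "\<dots> = (\<integral>\<^sup>+w. (\<integral>\<^sup>+s. ennreal (exponential_density 1 (w - s)) * ennreal (erlang_density i 1 s) * g w \<partial>lborel) \<partial>lborel)"
    by (rule lborel_pair.Fubini') measurable
  also have "\<dots> = (\<integral>\<^sup>+w. ennreal (erlang_density (Suc i) 1 w) * g w \<partial>lborel)"
    using convolution_erlang_density[of 1 0 i]
    by (simp add: nn_integral_multc fun_eq_iff)
  finally show ?thesis .
qed

lemma measurable_spacings:
  fixes l :: "nat \<Rightarrow> real" and d0 :: "real \<Rightarrow> ennreal" and G :: "real \<Rightarrow> real \<Rightarrow> ennreal"
  assumes k: "1 \<le> k"
  shows measurable_spacings_coord:
      "(\<lambda>x. x 1) \<in> borel_measurable (PiM {1..k} (\<lambda>_. lborel :: real measure))" (is ?X)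
    and measurable_spacings_prod: "(\<lambda>x. \<Prod>j\<in>{2..k}. ennreal (exponential_density (l j) (x j - x (j - 1))))
      \<in> borel_measurable (PiM {1..k} (\<lambda>_. lborel))" (is ?P)
    and measurable_spacings_sum: "(\<lambda>x. \<Sum>j\<in>{2..k}. l j * (x j - x (j - 1)))
      \<in> borel_measurable (PiM {1..k} (\<lambda>_. lborel))" (is ?S)
proof -
  have c: "(\<lambda>x. x j) \<in> borel_measurable (PiM {1..k} (\<lambda>_. lborel :: real measure))" if "j \<in> {1..k}" for j
    using that by (intro measurable_component_singleton[of _ _ "\<lambda>_. lborel", simplified]) auto
  show ?X using k by (intro c) simp
  show ?P
    by (intro borel_measurable_prod_ennreal measurable_compose[OF _ measurable_ennreal]
        measurable_compose[OF _ borel_measurable_erlang_density] borel_measurable_diff c) auto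
  show ?S
    by (intro borel_measurable_sum borel_measurable_times borel_measurable_const borel_measurable_diff c) auto
qed

context
  fixes d0 :: "real \<Rightarrow> ennreal" and l :: "nat \<Rightarrow> real"
  assumes d0 [measurable]: "d0 \<in> borel_measurable borel"
begin

text \<open>The last coordinate enters only the last spacing, so it can be integrated first. Its
  effect is to average \<open>G\<close> over one more standard exponential summand in the second
  argument.\<close>

lemma nn_integral_spacings_peel:
  fixes G :: "real \<Rightarrow> real \<Rightarrow> ennreal"
  assumes [measurable]: "case_prod G \<in> borel_measurable borel" and l: "0 < l (Suc k)" and k: "1 \<le> k"
  shows "(\<integral>\<^sup>+x. d0 (x 1) * (\<Prod>j\<in>{2..Suc k}. ennreal (exponential_density (l j) (x j - x (j - 1))))
        * G (x 1) (\<Sum>j\<in>{2..Suc k}. l j * (x j - x (j - 1))) \<partial>PiM {1..Suc k} (\<lambda>_. lborel))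
    = (\<integral>\<^sup>+x. d0 (x 1) * (\<Prod>j\<in>{2..k}. ennreal (exponential_density (l j) (x j - x (j - 1))))
        * (\<integral>\<^sup>+v. ennreal (exponential_density 1 v) * G (x 1) ((\<Sum>j\<in>{2..k}. l j * (x j - x (j - 1))) + v) \<partial>lborel)
        \<partial>PiM {1..k} (\<lambda>_. lborel))"
proof -
  interpret product_sigma_finite "\<lambda>_::nat. lborel :: real measure" by standard
  let ?P = "\<lambda>k x. \<Prod>j\<in>{2..k}. ennreal (exponential_density (l j) (x j - x (j - 1)))"
  let ?S = "\<lambda>k x. \<Sum>j\<in>{2..k}. l j * (x j - x (j - 1))"
  have G [measurable]: "case_prod G \<in> borel_measurable (borel \<Otimes>\<^sub>M borel)"
    using assms by (simp add: borel_prod)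
  have Gu [measurable]: "G u \<in> borel_measurable borel" for u by measurable
  have I: "{1..Suc k} = insert (Suc k) {1..k}" by auto
  have "(\<integral>\<^sup>+x. d0 (x 1) * ?P (Suc k) x * G (x 1) (?S (Suc k) x) \<partial>PiM {1..Suc k} (\<lambda>_. lborel))
    = (\<integral>\<^sup>+x. (\<integral>\<^sup>+y. d0 ((x(Suc k := y)) 1) * ?P (Suc k) (x(Suc k := y)) * G ((x(Suc k := y)) 1) (?S (Suc k) (x(Suc k := y))) \<partial>lborel)
        \<partial>PiM {1..k} (\<lambda>_. lborel))"
    unfolding I
  proof (rule product_nn_integral_insert)
    have c: "(\<lambda>x. d0 (X x) * P x * G (X x) (S x)) \<in> borel_measurable M"
      if [measurable]: "X \<in> borel_measurable M" "P \<in> borel_measurable M" "S \<in> borel_measurable M" for X P S and M :: "'z measure"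
      by measurable
    show "(\<lambda>x. d0 (x 1) * ?P (Suc k) x * G (x 1) (?S (Suc k) x))
      \<in> borel_measurable (Pi\<^sub>M (insert (Suc k) {1..k}) (\<lambda>_. lborel))"
      unfolding I[symmetric] by (intro c measurable_spacings) auto
  qed auto
  also have "\<dots> = (\<integral>\<^sup>+x. d0 (x 1) * ?P k x * (\<integral>\<^sup>+v. ennreal (exponential_density 1 v) * G (x 1) (?S k x + v) \<partial>lborel)
        \<partial>PiM {1..k} (\<lambda>_. lborel))"
  proof (rule nn_integral_cong)
    fix x :: "nat \<Rightarrow> real"
    have P: "?P (Suc k) (x(Suc k := y)) = ?P k x * ennreal (exponential_density (l (Suc k)) (y - x k))" for y
      using k by (simp add: prod.nat_ivl_Suc' mult.commute, intro arg_cong2[where f="(*)"] refl prod.cong) auto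
    have S: "?S (Suc k) (x(Suc k := y)) = ?S k x + l (Suc k) * (y - x k)" for y
      using k by (simp add: sum.nat_ivl_Suc' add.commute, intro arg_cong2[where f="(+)"] refl sum.cong) auto
    have x1: "(x(Suc k := y)) 1 = x 1" for y using k by simp
    show "(\<integral>\<^sup>+y. d0 ((x(Suc k := y)) 1) * ?P (Suc k) (x(Suc k := y)) * G ((x(Suc k := y)) 1) (?S (Suc k) (x(Suc k := y))) \<partial>lborel)
      = d0 (x 1) * ?P k x * (\<integral>\<^sup>+v. ennreal (exponential_density 1 v) * G (x 1) (?S k x + v) \<partial>lborel)"
      unfolding P S x1 nn_integral_exponential_shift[OF Gu l, of "x k" "x 1" "?S k x", symmetric]
      by (simp add: nn_integral_cmult[symmetric] ac_simps)
  qed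
  finally show ?thesis .
qed

text \<open>Induction on the number of spacings for all \<open>G\<close> at once: peeling off a
  spacing replaces \<open>G\<close> by an average of the same type, and the convolution lemma
  absorbs that average into the Erlang density. There are \<open>Suc i\<close> spacings, which
  matches index \<open>i\<close>.\<close>

lemma nn_integral_spacings:
  fixes G :: "real \<Rightarrow> real \<Rightarrow> ennreal"
  assumes "case_prod G \<in> borel_measurable borel" and "\<And>j. j \<in> {2..Suc (Suc i)} \<Longrightarrow> 0 < l j"
  shows "(\<integral>\<^sup>+x. d0 (x 1) * (\<Prod>j\<in>{2..Suc (Suc i)}. ennreal (exponential_density (l j) (x j - x (j - 1))))
        * G (x 1) (\<Sum>j\<in>{2..Suc (Suc i)}. l j * (x j - x (j - 1))) \<partial>PiM {1..Suc (Suc i)} (\<lambda>_. lborel))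
    = (\<integral>\<^sup>+u. d0 u * (\<integral>\<^sup>+v. ennreal (erlang_density i 1 v) * G u v \<partial>lborel) \<partial>lborel)"
  using assms
proof (induction i arbitrary: G)
  case 0
  interpret product_sigma_finite "\<lambda>_::nat. lborel :: real measure" by standard
  have [measurable]: "case_prod G \<in> borel_measurable (borel \<Otimes>\<^sub>M borel)"
    using 0 by (simp add: borel_prod)
  have "{Suc 0..Suc 0} = {Suc 0}" by auto
  moreover have "(\<lambda>u. d0 u * (\<integral>\<^sup>+v. ennreal (exponential_density 1 v) * G u v \<partial>lborel)) \<in> borel_measurable lborel"
    by measurable
  ultimately show ?case
    using 0 product_nn_integral_singleton[of "\<lambda>u. d0 u * (\<integral>\<^sup>+v. ennreal (exponential_density 1 v) * G u v \<partial>lborel)" "Suc 0"]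
    by (subst nn_integral_spacings_peel) auto
next
  case (Suc i)
  let ?G = "\<lambda>u s. \<integral>\<^sup>+v. ennreal (exponential_density 1 v) * G u (s + v) \<partial>lborel"
  have [measurable]: "case_prod G \<in> borel_measurable (borel \<Otimes>\<^sub>M borel)"
    using Suc.prems by (simp add: borel_prod)
  have "case_prod ?G \<in> borel_measurable (borel \<Otimes>\<^sub>M borel)" by measurable
  then have "case_prod ?G \<in> borel_measurable borel" by (simp add: borel_prod)
  then have IH: "(\<integral>\<^sup>+x. d0 (x 1) * (\<Prod>j\<in>{2..Suc (Suc i)}. ennreal (exponential_density (l j) (x j - x (j - 1))))
        * ?G (x 1) (\<Sum>j\<in>{2..Suc (Suc i)}. l j * (x j - x (j - 1))) \<partial>PiM {1..Suc (Suc i)} (\<lambda>_. lborel))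
    = (\<integral>\<^sup>+u. d0 u * (\<integral>\<^sup>+v. ennreal (erlang_density i 1 v) * ?G u v \<partial>lborel) \<partial>lborel)"
    by (rule Suc.IH) (use Suc.prems in auto)
  have "G u \<in> borel_measurable borel" for u by measurable
  note conv = nn_integral_erlang_convolution[OF this]
  have "0 < l (Suc (Suc (Suc i)))" "1 \<le> Suc (Suc i)" using Suc.prems(2) by auto
  note peel = nn_integral_spacings_peel[OF Suc.prems(1) this]
  show ?case unfolding peel IH conv ..
qed

end

text \<open>The joint law of the pivots, stated through integrals of arbitrary measurable functions:
  the iterated integral on the right says that they are independent, standard exponential and
  Erlang.\<close>

lemma nn_integral_pcos_law_pivots:
  fixes g :: "real \<Rightarrow> real \<Rightarrow> ennreal"
  assumes g: "case_prod g \<in> borel_measurable borel" and \<sigma>: "0 < \<sigma>"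
    and m: "m = Suc (Suc i)" and n: "gam m R 1 = real n"
  shows "(\<integral>\<^sup>+x. g (real n * (muhat x - \<mu>) / \<sigma>) (real m * sighat m R x / \<sigma>) \<partial>pcos_law m R \<mu> \<sigma>)
    = (\<integral>\<^sup>+u. ennreal (exponential_density 1 u) * (\<integral>\<^sup>+v. ennreal (erlang_density i 1 v) * g u v \<partial>lborel) \<partial>lborel)"
proof -
  have [measurable]: "case_prod g \<in> borel_measurable (borel \<Otimes>\<^sub>M borel)"
    using g by (simp add: borel_prod)
  have n0: "0 < real n" using gam_pos[of 1 m R] n m by simp
  define l where "l j = gam m R j / \<sigma>" for j
  have l: "0 < l j" if "j \<in> {2..m}" for j using that gam_pos[of j m R] \<sigma> by (simp add: l_def)
  define d0 where "d0 u = ennreal (expf \<mu> (\<sigma> / real n) u)" for u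
  have [measurable]: "expf a b \<in> borel_measurable borel" for a b
    unfolding expf_def[abs_def] by measurable
  have d0: "d0 \<in> borel_measurable borel" unfolding d0_def[abs_def] by measurable
  have [measurable]: "d0 \<in> borel_measurable borel" by fact
  let ?M = "PiM {1..m} (\<lambda>_. lborel :: real measure)"
  have [measurable]: "(\<lambda>x. x 1) \<in> borel_measurable ?M"
    using m by (intro measurable_spacings) simp
  have S: "real m * sighat m R x / \<sigma> = (\<Sum>j\<in>{2..m}. l j * (x j - x (j - 1)))" for x
  proof -
    have "real m * sighat m R x / \<sigma> = (\<Sum>j\<in>{2..m}. gam m R j * (x j - x (j - 1))) / \<sigma>"
      using m unfolding sighat_def by (simp del: sum.cl_ivl_Suc)
    then show ?thesis by (simp only: sum_divide_distrib l_def times_divide_eq_left)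
  qed
  have expf0: "0 \<le> expf \<mu> (\<sigma> / real n) u" for u using \<sigma> n0 by (simp add: expf_def)
  have D: "ennreal (pcos_density m R \<mu> \<sigma> x)
      = d0 (x 1) * (\<Prod>j\<in>{2..m}. ennreal (exponential_density (l j) (x j - x (j - 1))))" for x
  proof -
    have "0 \<le> exponential_density (l j) (x j - x (j - 1))" if "j \<in> {2..m}" for j
      using l[OF that] by simp
    then have "ennreal (\<Prod>j\<in>{2..m}. exponential_density (l j) (x j - x (j - 1)))
      = (\<Prod>j\<in>{2..m}. ennreal (exponential_density (l j) (x j - x (j - 1))))"
      by (rule prod_ennreal[symmetric])
    moreover have "pcos_density m R \<mu> \<sigma> x
      = expf \<mu> (\<sigma> / real n) (x 1) * (\<Prod>j\<in>{2..m}. exponential_density (l j) (x j - x (j - 1)))"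
      using m \<sigma> unfolding n[symmetric] l_def by (intro pcos_density_spacings) auto
    ultimately show ?thesis using expf0[of "x 1"] by (simp only: d0_def ennreal_mult')
  qed
  have [measurable]: "(\<lambda>x. ennreal (pcos_density m R \<mu> \<sigma> x)) \<in> borel_measurable ?M"
  proof -
    have "(\<lambda>x. d0 (x 1)) \<in> borel_measurable ?M" by measurable
    then show ?thesis
      unfolding D using m by (intro borel_measurable_times_ennreal measurable_spacings_prod) auto
  qed
  have [measurable]: "(\<lambda>x. real m * sighat m R x / \<sigma>) \<in> borel_measurable ?M"
    unfolding S using m by (intro measurable_spacings_sum) simp
  have [measurable]: "(\<lambda>x. g (real n * (muhat x - \<mu>) / \<sigma>) (real m * sighat m R x / \<sigma>)) \<in> borel_measurable ?M"
    unfolding muhat_def by measurable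
  let ?J = "\<lambda>u. \<integral>\<^sup>+v. ennreal (erlang_density i 1 v) * g u v \<partial>lborel"
  have "(\<integral>\<^sup>+x. g (real n * (muhat x - \<mu>) / \<sigma>) (real m * sighat m R x / \<sigma>) \<partial>pcos_law m R \<mu> \<sigma>)
    = (\<integral>\<^sup>+x. ennreal (pcos_density m R \<mu> \<sigma> x) * g (real n * (muhat x - \<mu>) / \<sigma>) (real m * sighat m R x / \<sigma>) \<partial>?M)"
    unfolding pcos_law_def by (rule nn_integral_density) measurable
  also have "\<dots> = (\<integral>\<^sup>+x. d0 (x 1) * (\<Prod>j\<in>{2..m}. ennreal (exponential_density (l j) (x j - x (j - 1))))
        * g (real n * (x 1 - \<mu>) / \<sigma>) (\<Sum>j\<in>{2..m}. l j * (x j - x (j - 1))) \<partial>?M)"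
    by (simp only: D S muhat_def)
  also have "\<dots> = (\<integral>\<^sup>+u. d0 u * ?J (real n * (u - \<mu>) / \<sigma>) \<partial>lborel)"
    unfolding m
  proof (rule nn_integral_spacings[OF d0])
    show "(\<lambda>(u, s). g (real n * (u - \<mu>) / \<sigma>) s) \<in> borel_measurable borel"
      unfolding borel_prod[symmetric] by measurable
  qed (use l m in auto)
  also have "\<dots> = ennreal (\<sigma> / real n) * (\<integral>\<^sup>+u. d0 (\<mu> + \<sigma> / real n * u) * ?J u \<partial>lborel)"
    using \<sigma> n0 by (subst nn_integral_real_affine[where c="\<sigma> / real n" and t=\<mu>]) auto
  also have "\<dots> = (\<integral>\<^sup>+u. ennreal (\<sigma> / real n) * (d0 (\<mu> + \<sigma> / real n * u) * ?J u) \<partial>lborel)"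
    by (subst nn_integral_cmult) auto
  also have "\<dots> = (\<integral>\<^sup>+u. ennreal (exponential_density 1 u) * ?J u \<partial>lborel)"
  \<comment> \<open>The point \<open>u = 0\<close> is set aside: \<open>expf\<close> vanishes at
    \<open>\<mu>\<close>, whereas the exponential density is 1 at 0.\<close>
  proof (rule nn_integral_cong_AE, use AE_lborel_singleton[of "0::real"] in eventually_elim)
    fix u :: real assume "u \<noteq> 0"
    then have "\<sigma> / real n * expf \<mu> (\<sigma> / real n) (\<mu> + \<sigma> / real n * u) = exponential_density 1 u"
      using \<sigma> n0 by (auto simp: expf_def exponential_density_def mult_le_0_iff divide_le_0_iff)
    then have "ennreal (\<sigma> / real n) * d0 (\<mu> + \<sigma> / real n * u) = ennreal (exponential_density 1 u)"
      using \<sigma> expf0 by (simp add: d0_def ennreal_mult[symmetric])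
    then show "ennreal (\<sigma> / real n) * (d0 (\<mu> + \<sigma> / real n * u) * ?J u) = ennreal (exponential_density 1 u) * ?J u"
      by (simp add: mult.assoc[symmetric])
  qed
  finally show ?thesis .
qed

section \<open>Probabilities of events in the pivots\<close>

lemma nn_integral_exponential_Icc_ln:
  assumes "0 < a" "a < b" "b < 1"
  shows "(\<integral>\<^sup>+u. ennreal (exponential_density 1 u) * indicator {- ln b..- ln a} u \<partial>lborel) = ennreal (b - a)"
proof -
  have ln: "0 \<le> - ln b" "- ln b \<le> - ln a" using assms by auto
  have "(\<integral>\<^sup>+u. ennreal (exponential_density 1 u) * indicator {- ln b..- ln a} u \<partial>lborel)
    = (\<integral>\<^sup>+u. ennreal (exp (- u)) * indicator {- ln b..- ln a} u \<partial>lborel)"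
    using ln by (intro nn_integral_cong) (auto simp: exponential_density_def indicator_def)
  \<comment> \<open>The survival function \<open>exp (- u)\<close> takes the values \<open>b\<close>
    and \<open>a\<close> at the two end points.\<close>
  also have "\<dots> = ennreal (- exp (- (- ln a)) - - exp (- (- ln b)))"
    using ln by (intro nn_integral_FTC_Icc) (auto intro!: derivative_eq_intros)
  finally show ?thesis using assms by simp
qed

lemma nn_integral_power_Icc:
  assumes "0 \<le> a" "a \<le> b"
  shows "(\<integral>\<^sup>+v. ennreal (v ^ i / fact i) * indicator {a..b} v \<partial>lborel)
    = ennreal ((b ^ Suc i - a ^ Suc i) / fact (Suc i))"
proof -
  have "(\<integral>\<^sup>+v. ennreal (v ^ i / fact i) * indicator {a..b} v \<partial>lborel)
    = ennreal (b ^ Suc i / fact (Suc i) - a ^ Suc i / fact (Suc i))"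
  proof (rule nn_integral_FTC_Icc)
    fix v :: real
    have "((\<lambda>v. v ^ Suc i / fact (Suc i)) has_real_derivative real (Suc i) * v ^ i / fact (Suc i)) (at v)"
      using DERIV_cdivide[OF DERIV_pow[of "Suc i" v UNIV], of "fact (Suc i)"]
      by (simp del: fact_Suc power_Suc of_nat_Suc)
    also have "real (Suc i) * v ^ i / fact (Suc i) = v ^ i / fact i"
      by (simp only: fact_Suc of_nat_mult mult_divide_mult_cancel_left of_nat_eq_0_iff nat.distinct) simp
    finally show "((\<lambda>v. v ^ Suc i / fact (Suc i)) has_real_derivative v ^ i / fact i) (at v)" .
  qed (use assms in auto)
  then show ?thesis by (simp only: diff_divide_distrib)
qed

text \<open>In the coordinates \<open>w = u + v\<close> and \<open>v\<close> the condition on the ratio \<open>u / v\<close> selects the interval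
  \<open>{w / (1 + r2)..w / (1 + r1)}\<close> of values of \<open>v\<close>, whose conditional probability given \<open>w\<close> does not depend
  on \<open>w\<close>: the sum and the ratio of the pivots are independent.\<close>

lemma nn_integral_exponential_erlang_ratio:
  fixes h :: "real \<Rightarrow> ennreal"
  assumes [measurable]: "h \<in> borel_measurable borel" and r: "0 < r1" "r1 \<le> r2"
  shows "(\<integral>\<^sup>+u. ennreal (exponential_density 1 u) * (\<integral>\<^sup>+v. ennreal (erlang_density i 1 v) *
        (h (u + v) * indicator {v * r1..v * r2} u) \<partial>lborel) \<partial>lborel)
    = ennreal (inverse (1 + r1) ^ Suc i - inverse (1 + r2) ^ Suc i)
      * (\<integral>\<^sup>+w. ennreal (erlang_density (Suc i) 1 w) * h w \<partial>lborel)"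
proof -
  have ind [measurable]: "(\<lambda>(u, v). indicator {v * r1..v * r2} u :: ennreal) \<in> borel_measurable (borel \<Otimes>\<^sub>M borel)"
    unfolding indicator_def atLeastAtMost_iff by measurable
  let ?E = "\<lambda>w v. ennreal (exponential_density 1 (w - v)) * ennreal (erlang_density i 1 v) *
        (h w * indicator {v * r1..v * r2} (w - v))"
  have "(\<integral>\<^sup>+u. ennreal (exponential_density 1 u) * (\<integral>\<^sup>+v. ennreal (erlang_density i 1 v) *
        (h (u + v) * indicator {v * r1..v * r2} u) \<partial>lborel) \<partial>lborel)
    = (\<integral>\<^sup>+u. (\<integral>\<^sup>+v. ennreal (exponential_density 1 u) * ennreal (erlang_density i 1 v) *
        (h (u + v) * indicator {v * r1..v * r2} u) \<partial>lborel) \<partial>lborel)"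
    by (simp add: nn_integral_cmult[symmetric] mult.assoc)
  also have "\<dots> = (\<integral>\<^sup>+v. (\<integral>\<^sup>+u. ennreal (exponential_density 1 u) * ennreal (erlang_density i 1 v) *
        (h (u + v) * indicator {v * r1..v * r2} u) \<partial>lborel) \<partial>lborel)"
    by (rule lborel_pair.Fubini') measurable
  also have "\<dots> = (\<integral>\<^sup>+v. (\<integral>\<^sup>+w. ?E w v \<partial>lborel) \<partial>lborel)"
  proof (rule nn_integral_cong)
    fix v :: real
    show "(\<integral>\<^sup>+u. ennreal (exponential_density 1 u) * ennreal (erlang_density i 1 v) *
        (h (u + v) * indicator {v * r1..v * r2} u) \<partial>lborel) = (\<integral>\<^sup>+w. ?E w v \<partial>lborel)"
      by (subst nn_integral_real_affine[where c=1 and t="- v"]) auto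
  qed
  also have "\<dots> = (\<integral>\<^sup>+w. (\<integral>\<^sup>+v. ?E w v \<partial>lborel) \<partial>lborel)"
    by (rule lborel_pair.Fubini') measurable
  also have "\<dots> = (\<integral>\<^sup>+w. ennreal (inverse (1 + r1) ^ Suc i - inverse (1 + r2) ^ Suc i)
      * (ennreal (erlang_density (Suc i) 1 w) * h w) \<partial>lborel)"
  proof (rule nn_integral_cong)
    fix w :: real
    show "(\<integral>\<^sup>+v. ?E w v \<partial>lborel) = ennreal (inverse (1 + r1) ^ Suc i - inverse (1 + r2) ^ Suc i)
      * (ennreal (erlang_density (Suc i) 1 w) * h w)"
    proof (cases "0 \<le> w")
      case True
      let ?a = "w * inverse (1 + r2)" and ?b = "w * inverse (1 + r1)"
      have inv: "inverse (1 + r2) \<le> inverse (1 + r1)" "0 \<le> inverse (1 + r2)"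
        using r by (auto intro!: le_imp_inverse_le)
      have ab: "0 \<le> ?a" "?a \<le> ?b" using True inv by (auto intro!: mult_left_mono)
      \<comment> \<open>The two exponential factors combine to \<open>exp (- w)\<close>, leaving a
        pure power of \<open>v\<close>; solving the ratio condition for \<open>v\<close> gives the
        interval between \<open>?a\<close> and \<open>?b\<close>.\<close>
      have E: "?E w v = ennreal (exp (- w)) * h w * (ennreal (v ^ i / fact i) * indicator {?a..?b} v)" for v
      proof (cases "0 \<le> v \<and> v * r1 \<le> w - v \<and> w - v \<le> v * r2")
        case v: True
        then have "0 \<le> v * r1" using r by simp
        then have "0 \<le> w - v" using v by linarith
        then have "ennreal (exponential_density 1 (w - v)) * ennreal (erlang_density i 1 v)
          = ennreal (exp (- w)) * ennreal (v ^ i / fact i)"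
          using v by (simp add: exponential_density_def erlang_density_def ennreal_mult[symmetric] exp_diff exp_minus field_simps)
        moreover have "v \<in> {?a..?b}" using v r by (auto simp: field_simps)
        ultimately show ?thesis using v by (simp add: ac_simps)
      next
        case v: False
        have "v < 0 \<or> v \<notin> {?a..?b}" using v r by (auto simp: field_simps)
        then have "v \<notin> {?a..?b}" using ab by auto
        moreover have "v < 0 \<or> w - v \<notin> {v * r1..v * r2}" using v by auto
        ultimately show ?thesis by (auto simp: erlang_density_def)
      qed
      have "(\<integral>\<^sup>+v. ?E w v \<partial>lborel)
        = ennreal (exp (- w)) * h w * ennreal ((?b ^ Suc i - ?a ^ Suc i) / fact (Suc i))"
        unfolding E by (subst nn_integral_cmult) (simp_all add: nn_integral_power_Icc[OF ab] del: power_Suc fact_Suc)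
      \<comment> \<open>Both end points are proportional to \<open>w\<close>, so
        \<open>w ^ Suc i\<close> factors out. Together with \<open>exp (- w)\<close> it forms the
        Erlang density of index \<open>Suc i\<close>, and the remaining factor is free of
        \<open>w\<close>.\<close>
      also have "(?b ^ Suc i - ?a ^ Suc i) / fact (Suc i)
        = (inverse (1 + r1) ^ Suc i - inverse (1 + r2) ^ Suc i) * (w ^ Suc i / fact (Suc i))"
        by (simp add: power_mult_distrib algebra_simps diff_divide_distrib del: power_Suc fact_Suc)
      also have "ennreal (exp (- w)) * h w * ennreal \<dots>
        = ennreal (inverse (1 + r1) ^ Suc i - inverse (1 + r2) ^ Suc i)
          * (ennreal (w ^ Suc i / fact (Suc i)) * ennreal (exp (- w)) * h w)"
        using power_mono[OF inv, of "Suc i"] True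
        by (subst ennreal_mult) (auto simp del: power_Suc fact_Suc simp: ac_simps)
      also have "ennreal (w ^ Suc i / fact (Suc i)) * ennreal (exp (- w)) = ennreal (erlang_density (Suc i) 1 w)"
        using True by (simp add: erlang_density_def ennreal_mult[symmetric] del: power_Suc fact_Suc)
      finally show ?thesis .
    next
      case False
      \<comment> \<open>For negative \<open>w\<close> the conditions \<open>0 \<le> v\<close> and
        \<open>v * r1 \<le> w - v\<close> exclude each other.\<close>
      have E: "?E w v = 0" for v
      proof (cases "v < 0")
        case nonneg: False
        then have "0 \<le> v * r1" using r by simp
        then have "w - v \<notin> {v * r1..v * r2}" using nonneg False by auto
        then show ?thesis by simp
      qed (simp add: erlang_density_def)
      show ?thesis unfolding E using False by (simp add: erlang_density_def)
    qed
  qed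
  also have "\<dots> = ennreal (inverse (1 + r1) ^ Suc i - inverse (1 + r2) ^ Suc i)
      * (\<integral>\<^sup>+w. ennreal (erlang_density (Suc i) 1 w) * h w \<partial>lborel)"
    by (rule nn_integral_cmult) measurable
  finally show ?thesis .
qed

section \<open>Exact coverage\<close>

text \<open>Once coverage is equivalent to the pivots lying in a fixed set \<open>A\<close>, its
  probability no longer depends on the parameter and is the mass of \<open>A\<close> under the pivot
  law. Closedness of \<open>A\<close> makes the coverage event measurable.\<close>

lemma exact_conf_bandI:
  assumes m: "m = Suc (Suc i)" and n: "gam m R 1 = real n"
    and pivot: "\<And>x \<mu> \<sigma>. 0 < \<sigma> \<Longrightarrow> fgraph (expF \<mu> \<sigma>) \<subseteq> B x
      \<longleftrightarrow> (real n * (muhat x - \<mu>) / \<sigma>, real m * sighat m R x / \<sigma>) \<in> A"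
    and closed: "closed A"
    and interval: "\<And>x t. is_interval {y. (t, y) \<in> B x}"
    and prob: "(\<integral>\<^sup>+u. ennreal (exponential_density 1 u)
      * (\<integral>\<^sup>+v. ennreal (erlang_density i 1 v) * indicator A (u, v) \<partial>lborel) \<partial>lborel) = ennreal (1 - p)"
    and "p < 1"
  shows "exact_conf_band m R B p"
  unfolding exact_conf_band_def
proof (intro allI impI conjI)
  have A: "A \<in> sets borel" using closed by (rule borel_closed)
  then have [measurable]: "A \<in> sets (borel \<Otimes>\<^sub>M borel)" unfolding borel_prod .
  fix \<mu> \<sigma> :: real assume \<sigma>: "0 < \<sigma>"
  let ?M = "pcos_law m R \<mu> \<sigma>"
  let ?S = "{x \<in> space ?M. fgraph (expF \<mu> \<sigma>) \<subseteq> B x}"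
  have sets [measurable_cong]: "sets ?M = sets (PiM {1..m} (\<lambda>_. lborel))" by (simp add: pcos_law_def)
  have "(\<lambda>x. x 1) \<in> borel_measurable (PiM {1..m} (\<lambda>_. lborel :: real measure))"
    "(\<lambda>x. \<Sum>j\<in>{2..m}. gam m R j * (x j - x (j - 1))) \<in> borel_measurable (PiM {1..m} (\<lambda>_. lborel))"
    using m by (auto intro!: measurable_spacings simp del: One_nat_def sum.cl_ivl_Suc)
  note [measurable] = this
  have [measurable]: "(\<lambda>x. real n * (muhat x - \<mu>) / \<sigma>) \<in> borel_measurable ?M"
    "(\<lambda>x. real m * sighat m R x / \<sigma>) \<in> borel_measurable ?M"
    unfolding muhat_def sighat_def by measurable
  have S: "?S = {x \<in> space ?M. (real n * (muhat x - \<mu>) / \<sigma>, real m * sighat m R x / \<sigma>) \<in> A}"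
    using pivot[OF \<sigma>] by simp
  show meas: "?S \<in> sets ?M" unfolding S by measurable
  have "emeasure ?M ?S = (\<integral>\<^sup>+x. indicator ?S x \<partial>?M)" using meas by simp
  also have "\<dots> = (\<integral>\<^sup>+x. indicator A (real n * (muhat x - \<mu>) / \<sigma>, real m * sighat m R x / \<sigma>) \<partial>?M)"
    unfolding S by (intro nn_integral_cong) (auto simp: indicator_def)
  also have "\<dots> = ennreal (1 - p)"
    unfolding prob[symmetric]
    by (rule nn_integral_pcos_law_pivots[where g="\<lambda>u v. indicator A (u, v)", OF _ \<sigma> m n])
       (simp, rule borel_measurable_indicator[OF A])
  finally show "measure ?M ?S = 1 - p" using \<open>p < 1\<close> by (simp add: measure_def)
qed (simp add: interval)

section \<open>The two confidence regions in terms of the pivots\<close>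

context
  fixes n m i :: nat and R :: "nat \<Rightarrow> nat" and p :: real
  assumes m: "m = Suc (Suc i)" and n: "gam m R 1 = real n" and p: "0 < p" "p < 1"
begin

lemma n_pos: "0 < real n"
  using gam_pos[of 1 m R] n m by simp

text \<open>\<open>q2 p - q1 p\<close> is \<open>sqrt (1 - p)\<close>: each region imposes two
  independent conditions of this probability, and their product is the required level.\<close>

lemma q1_q2: "0 < q1 p" "q1 p < q2 p" "q2 p < 1" "(q2 p - q1 p)\<^sup>2 = 1 - p"
proof -
  have "0 < sqrt (1 - p)" "sqrt (1 - p) < 1" "(sqrt (1 - p))\<^sup>2 = 1 - p" using p by auto
  then show "0 < q1 p" "q1 p < q2 p" "q2 p < 1" "(q2 p - q1 p)\<^sup>2 = 1 - p"
    by (auto simp: q1_def q2_def field_simps power2_eq_square)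
qed

lemma degrees_of_freedom: "2 * m - 2 = 2 * Suc i" "2 * m = 2 * Suc (Suc i)" "real m - 1 = real (Suc i)"
  using m by auto

lemma a_q_eq: "a_q n x q \<sigma> = muhat x - \<sigma> * (- ln q / real n)"
  by (simp add: a_q_def)

lemma C1_eq_region1:
  "C1 n m R p x = region1 (muhat x) (- ln (q2 p) / real n) (- ln (q1 p) / real n) (sig_q m R x (q2 p)) (sig_q m R x (q1 p))"
  by (simp only: C1_def region1_def a_q_eq)

lemma C2_eq_region2:
  "C2 n m R p x = region2 (muhat x + real m * sighat m R x / real n)
    (chi2_quantile (2 * m) (q1 p) / (2 * real n)) (chi2_quantile (2 * m) (q2 p) / (2 * real n))
    (mu_q n m R x (q1 p)) (mu_q n m R x (q2 p))"
  and b_q_eq: "b_q n m R x q \<mu> = (muhat x + real m * sighat m R x / real n - \<mu>) / (chi2_quantile (2 * m) q / (2 * real n))"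
proof -
  show "b_q n m R x q \<mu> = (muhat x + real m * sighat m R x / real n - \<mu>) / (chi2_quantile (2 * m) q / (2 * real n))" for q \<mu>
    \<comment> \<open>A vanishing quantile is harmless here: division by 0 yields 0 on both
      sides.\<close>
    using n_pos by (cases "chi2_quantile (2 * m) q = 0") (simp_all add: b_q_def field_simps)
  then show "C2 n m R p x = region2 (muhat x + real m * sighat m R x / real n)
    (chi2_quantile (2 * m) (q1 p) / (2 * real n)) (chi2_quantile (2 * m) (q2 p) / (2 * real n))
    (mu_q n m R x (q1 p)) (mu_q n m R x (q2 p))"
    by (simp add: C2_def region2_def)
qed

lemma region1_bounds:
  assumes "0 < sighat m R x"
  shows "0 < - ln (q2 p) / real n" "- ln (q2 p) / real n \<le> - ln (q1 p) / real n"
    "0 < sig_q m R x (q2 p)" "sig_q m R x (q2 p) \<le> sig_q m R x (q1 p)"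
proof -
  show "0 < - ln (q2 p) / real n" "- ln (q2 p) / real n \<le> - ln (q1 p) / real n"
    using q1_q2 n_pos by (auto intro!: divide_neg_pos divide_right_mono)
  have "0 < chi2_quantile (2 * m - 2) (q1 p)" "chi2_quantile (2 * m - 2) (q1 p) < chi2_quantile (2 * m - 2) (q2 p)"
    unfolding degrees_of_freedom(1) by (rule chi2_quantile_even q1_q2)+
  moreover have "0 < 2 * real m * sighat m R x" using assms m by simp
  ultimately show "0 < sig_q m R x (q2 p)" "sig_q m R x (q2 p) \<le> sig_q m R x (q1 p)"
    unfolding sig_q_def by (auto intro!: divide_pos_pos divide_left_mono mult_pos_pos)
qed

lemma region2_bounds:
  assumes "0 < sighat m R x"
  shows "0 < chi2_quantile (2 * m) (q1 p) / (2 * real n)"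
    "chi2_quantile (2 * m) (q1 p) / (2 * real n) \<le> chi2_quantile (2 * m) (q2 p) / (2 * real n)"
    "mu_q n m R x (q2 p) \<le> mu_q n m R x (q1 p)" "mu_q n m R x (q1 p) < muhat x + real m * sighat m R x / real n"
proof -
  have "0 < chi2_quantile (2 * m) (q1 p)" "chi2_quantile (2 * m) (q1 p) < chi2_quantile (2 * m) (q2 p)"
    unfolding degrees_of_freedom(2) by (rule chi2_quantile_even q1_q2)+
  then show "0 < chi2_quantile (2 * m) (q1 p) / (2 * real n)"
    "chi2_quantile (2 * m) (q1 p) / (2 * real n) \<le> chi2_quantile (2 * m) (q2 p) / (2 * real n)"
    using n_pos by (auto intro!: divide_pos_pos divide_right_mono)
  have f: "0 < F_quantile 2 (2 * m - 2) (q1 p)" "F_quantile 2 (2 * m - 2) (q1 p) < F_quantile 2 (2 * m - 2) (q2 p)"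
    unfolding degrees_of_freedom(1) by (rule F_quantile_2_even q1_q2)+
  have c: "0 < (real m - 1) * real n" "0 < real m * sighat m R x" using assms m n_pos by auto
  show "mu_q n m R x (q2 p) \<le> mu_q n m R x (q1 p)"
    unfolding mu_q_def using f c by (auto intro!: divide_right_mono mult_left_mono)
  have "0 < real m * sighat m R x * F_quantile 2 (2 * m - 2) (q1 p) / ((real m - 1) * real n)"
    using f c by (intro divide_pos_pos mult_pos_pos[of "real m * sighat m R x"])
  moreover have "0 < real m * sighat m R x / real n" using c n_pos by simp
  ultimately show "mu_q n m R x (q1 p) < muhat x + real m * sighat m R x / real n"
    unfolding mu_q_def by linarith
qed

lemma band_C1:
  assumes "0 < sighat m R x"
  shows "band (C1 n m R p x) = {(t, y). 0 \<le> y \<and> y \<le> 1 \<and> U1 n m R p x t \<le> y \<and> y \<le> O1 n m R p x t}"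
  unfolding C1_eq_region1 band_region1[OF region1_bounds[OF assms]] U1_def O1_def a_q_eq ..

lemma band_C2:
  assumes "0 < sighat m R x"
  shows "band (C2 n m R p x) = {(t, y). 0 \<le> y \<and> y \<le> 1 \<and> U2 n m R p x t \<le> y \<and> y \<le> O2 n m R p x t}"
  unfolding C2_eq_region2 band_region2[OF region2_bounds[OF assms]] U2_def O2_def b_q_eq ..

lemma mem_C1_iff:
  assumes "0 < \<sigma>"
  shows "(\<mu>, \<sigma>) \<in> C1 n m R p x \<longleftrightarrow>
    real n * (muhat x - \<mu>) / \<sigma> \<in> {- ln (q2 p)..- ln (q1 p)} \<and>
    2 * (real m * sighat m R x / \<sigma>) \<in> {chi2_quantile (2 * m - 2) (q1 p)..chi2_quantile (2 * m - 2) (q2 p)}"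
proof -
  have "0 < chi2_quantile (2 * m - 2) (q1 p)" "chi2_quantile (2 * m - 2) (q1 p) < chi2_quantile (2 * m - 2) (q2 p)"
    unfolding degrees_of_freedom(1) by (rule chi2_quantile_even q1_q2)+
  then show ?thesis
    using assms n_pos by (simp add: C1_def a_q_def sig_q_def) (auto simp: field_simps)
qed

text \<open>One condition concerns the ratio and the other the sum of the pivots. The ratio
  condition is written without division by \<open>v\<close>, so it makes sense for samples of every
  kind, also where \<open>sighat\<close> is 0 or negative.\<close>

lemma mem_C2_iff:
  assumes "0 < \<sigma>"
  defines "u \<equiv> \<lambda>x \<mu>. real n * (muhat x - \<mu>) / \<sigma>" and "v \<equiv> \<lambda>x. real m * sighat m R x / \<sigma>"
  shows "(\<mu>, \<sigma>) \<in> C2 n m R p x \<longleftrightarrow>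
    u x \<mu> \<in> {v x * (F_quantile 2 (2 * m - 2) (q1 p) / (real m - 1))..v x * (F_quantile 2 (2 * m - 2) (q2 p) / (real m - 1))} \<and>
    2 * (u x \<mu> + v x) \<in> {chi2_quantile (2 * m) (q1 p)..chi2_quantile (2 * m) (q2 p)}"
proof -
  have chi: "0 < chi2_quantile (2 * m) (q1 p)" "chi2_quantile (2 * m) (q1 p) < chi2_quantile (2 * m) (q2 p)"
    unfolding degrees_of_freedom(2) by (rule chi2_quantile_even q1_q2)+
  have mu: "mu_q n m R x q \<le> \<mu> \<longleftrightarrow> u x \<mu> \<le> v x * (F_quantile 2 (2 * m - 2) q / (real m - 1))"
    "\<mu> \<le> mu_q n m R x q \<longleftrightarrow> v x * (F_quantile 2 (2 * m - 2) q / (real m - 1)) \<le> u x \<mu>" for q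
  proof -
    have eq: "mu_q n m R x q = muhat x - \<sigma> * (v x * (F_quantile 2 (2 * m - 2) q / (real m - 1))) / real n"
      using assms(1) by (simp add: mu_q_def v_def)
    have "muhat x - \<sigma> * w / real n \<le> \<mu> \<longleftrightarrow> u x \<mu> \<le> w" "\<mu> \<le> muhat x - \<sigma> * w / real n \<longleftrightarrow> w \<le> u x \<mu>" for w
      using n_pos assms(1) by (auto simp: u_def field_simps)
    then show "mu_q n m R x q \<le> \<mu> \<longleftrightarrow> u x \<mu> \<le> v x * (F_quantile 2 (2 * m - 2) q / (real m - 1))"
      "\<mu> \<le> mu_q n m R x q \<longleftrightarrow> v x * (F_quantile 2 (2 * m - 2) q / (real m - 1)) \<le> u x \<mu>"
      unfolding eq by blast+
  qed
  have b: "b_q n m R x (q2 p) \<mu> \<le> \<sigma> \<longleftrightarrow> 2 * (u x \<mu> + v x) \<le> chi2_quantile (2 * m) (q2 p)"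
    "\<sigma> \<le> b_q n m R x (q1 p) \<mu> \<longleftrightarrow> chi2_quantile (2 * m) (q1 p) \<le> 2 * (u x \<mu> + v x)"
    using chi assms(1) by (auto simp: b_q_def u_def v_def field_simps)
  show ?thesis using assms(1) by (auto simp: C2_def mu b)
qed

text \<open>For positive \<open>sighat\<close> this is the statement on trapezoids. Otherwise the
  region is empty, because its chi-square condition forces a positive pivot, and an empty band
  contains no graph.\<close>

lemma fgraph_subset_band_C1_iff:
  assumes "0 < \<sigma>"
  shows "fgraph (expF \<mu> \<sigma>) \<subseteq> band (C1 n m R p x) \<longleftrightarrow> (\<mu>, \<sigma>) \<in> C1 n m R p x"
proof (cases "0 < sighat m R x")
  case True
  then show ?thesis
    unfolding C1_eq_region1 using assms by (intro fgraph_subset_band_region1_iff region1_bounds)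
next
  case False
  have "\<theta> \<notin> C1 n m R p x" for \<theta>
  proof
    assume \<theta>: "\<theta> \<in> C1 n m R p x"
    obtain \<mu>' \<sigma>' where [simp]: "\<theta> = (\<mu>', \<sigma>')" by fastforce
    have \<sigma>': "0 < \<sigma>'" using \<theta> by (simp add: C1_def)
    have "0 < chi2_quantile (2 * m - 2) (q1 p)"
      unfolding degrees_of_freedom(1) by (rule chi2_quantile_even q1_q2)+
    then have "0 < real m * sighat m R x / \<sigma>'" using \<theta> by (simp add: mem_C1_iff[OF \<sigma>'])
    then show False using False \<sigma>' m by (simp add: zero_less_divide_iff zero_less_mult_iff)
  qed
  then have "C1 n m R p x = {}" by auto
  then show ?thesis by (auto simp: band_def fgraph_def)
qed

lemma fgraph_subset_band_C2_iff:
  assumes "0 < \<sigma>"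
  shows "fgraph (expF \<mu> \<sigma>) \<subseteq> band (C2 n m R p x) \<longleftrightarrow> (\<mu>, \<sigma>) \<in> C2 n m R p x"
proof (cases "0 < sighat m R x")
  case True
  then show ?thesis
    unfolding C2_eq_region2 using assms by (intro fgraph_subset_band_region2_iff region2_bounds)
next
  case False
  have "\<theta> \<notin> C2 n m R p x" for \<theta>
  proof
    assume \<theta>: "\<theta> \<in> C2 n m R p x"
    obtain \<mu>' \<sigma>' where [simp]: "\<theta> = (\<mu>', \<sigma>')" by fastforce
    have \<sigma>': "0 < \<sigma>'" using \<theta> by (simp add: C2_def)
    let ?v = "real m * sighat m R x / \<sigma>'" and ?f = "\<lambda>q. F_quantile 2 (2 * m - 2) q / (real m - 1)"
    have chi: "0 < chi2_quantile (2 * m) (q1 p)"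
      unfolding degrees_of_freedom(2) by (rule chi2_quantile_even q1_q2)+
    have f: "0 < F_quantile 2 (2 * m - 2) (q1 p)" "F_quantile 2 (2 * m - 2) (q1 p) < F_quantile 2 (2 * m - 2) (q2 p)"
      unfolding degrees_of_freedom(1) by (rule F_quantile_2_even q1_q2)+
    then have f': "0 < ?f (q1 p)" "?f (q1 p) < ?f (q2 p)" using m by (auto intro!: divide_strict_right_mono)
    have v: "?v \<le> 0" using False \<sigma>' by (simp add: divide_le_0_iff mult_le_0_iff)
    \<comment> \<open>Eliminating the first pivot: the upper ratio bound and the positive lower
      bound on the sum cannot both hold when \<open>?v\<close> is nonpositive.\<close>
    have "?v * ?f (q1 p) \<le> ?v * ?f (q2 p)" "0 < ?v * ?f (q2 p) + ?v"
      using \<theta> chi by (auto simp: mem_C2_iff[OF \<sigma>'])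
    moreover have "?v * ?f (q2 p) \<le> 0" using v f' by (intro mult_nonpos_nonneg) auto
    ultimately show False using v by linarith
  qed
  then have "C2 n m R p x = {}" by auto
  then show ?thesis by (auto simp: band_def fgraph_def)
qed

text \<open>The coverage event is a rectangle in the independent pivots, so its probability is the
  product of two factors \<open>q2 p - q1 p\<close>.\<close>

lemma exact_conf_band_C1: "exact_conf_band m R (\<lambda>x. band (C1 n m R p x)) p"
proof -
  let ?I = "{- ln (q2 p)..- ln (q1 p)}"
  let ?J = "{chi2_quantile (2 * m - 2) (q1 p)..chi2_quantile (2 * m - 2) (q2 p)}"
  let ?A = "{(u, v). u \<in> ?I \<and> 2 * v \<in> ?J}"
  have ind: "indicator ?A (u, v) = indicator ?I u * (indicator ?J (2 * v) :: ennreal)" for u v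
    by (auto simp: indicator_def)
  show ?thesis
  proof (rule exact_conf_bandI[OF m n, where A="?A"])
    show "closed ?A"
      unfolding atLeastAtMost_iff case_prod_beta
      by (intro closed_Collect_conj closed_Collect_le continuous_intros)
    show "fgraph (expF \<mu> \<sigma>) \<subseteq> band (C1 n m R p x)
      \<longleftrightarrow> (real n * (muhat x - \<mu>) / \<sigma>, real m * sighat m R x / \<sigma>) \<in> ?A" if "0 < \<sigma>" for x \<mu> \<sigma>
      unfolding fgraph_subset_band_C1_iff[OF that] mem_C1_iff[OF that] by simp
    show "is_interval {y. (t, y) \<in> band (C1 n m R p x)}" for x t
      unfolding C1_eq_region1 by (intro is_interval_section_band convex_region1) (auto simp: region1_def)
    have J: "(\<integral>\<^sup>+v. ennreal (erlang_density i 1 v) * indicator ?J (2 * v) \<partial>lborel) = ennreal (q2 p - q1 p)"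
      unfolding degrees_of_freedom(1) by (intro chi2_quantile_even q1_q2)
    have "(\<integral>\<^sup>+u. ennreal (exponential_density 1 u)
        * (\<integral>\<^sup>+v. ennreal (erlang_density i 1 v) * indicator ?A (u, v) \<partial>lborel) \<partial>lborel)
      = (\<integral>\<^sup>+u. ennreal (exponential_density 1 u) * indicator ?I u
        * (\<integral>\<^sup>+v. ennreal (erlang_density i 1 v) * indicator ?J (2 * v) \<partial>lborel) \<partial>lborel)"
      unfolding ind by (intro nn_integral_cong) (simp add: nn_integral_cmult[symmetric] ac_simps)
    also have "\<dots> = ennreal (q2 p - q1 p) * ennreal (q2 p - q1 p)"
      unfolding J by (subst nn_integral_multc) (simp_all only: nn_integral_exponential_Icc_ln[OF q1_q2(1-3)], measurable)
    also have "\<dots> = ennreal (1 - p)"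
      using q1_q2 by (simp add: ennreal_mult[symmetric] power2_eq_square)
    finally show "(\<integral>\<^sup>+u. ennreal (exponential_density 1 u)
        * (\<integral>\<^sup>+v. ennreal (erlang_density i 1 v) * indicator ?A (u, v) \<partial>lborel) \<partial>lborel) = ennreal (1 - p)" .
  qed (fact p)
qed

text \<open>The coverage event is an intersection of a condition on the ratio, whose law is an
  F-distribution up to scale, and one on the sum, which is half a chi-square variable. Independence
  of ratio and sum again gives the square of \<open>q2 p - q1 p\<close>.\<close>

lemma exact_conf_band_C2: "exact_conf_band m R (\<lambda>x. band (C2 n m R p x)) p"
proof -
  let ?f = "\<lambda>q. F_quantile 2 (2 * m - 2) q / (real m - 1)"
  let ?J = "{chi2_quantile (2 * m) (q1 p)..chi2_quantile (2 * m) (q2 p)}"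
  let ?A = "{(u, v). u \<in> {v * ?f (q1 p)..v * ?f (q2 p)} \<and> 2 * (u + v) \<in> ?J}"
  have ind: "indicator ?A (u, v) = (indicator ?J (2 * (u + v)) * indicator {v * ?f (q1 p)..v * ?f (q2 p)} u :: ennreal)" for u v
    by (auto simp: indicator_def)
  show ?thesis
  proof (rule exact_conf_bandI[OF m n, where A="?A"])
    show "closed ?A"
      unfolding atLeastAtMost_iff case_prod_beta
      by (intro closed_Collect_conj closed_Collect_le continuous_intros)
    show "fgraph (expF \<mu> \<sigma>) \<subseteq> band (C2 n m R p x)
      \<longleftrightarrow> (real n * (muhat x - \<mu>) / \<sigma>, real m * sighat m R x / \<sigma>) \<in> ?A" if "0 < \<sigma>" for x \<mu> \<sigma>
      unfolding fgraph_subset_band_C2_iff[OF that] mem_C2_iff[OF that] by simp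
    show "is_interval {y. (t, y) \<in> band (C2 n m R p x)}" for x t
      unfolding C2_eq_region2 by (intro is_interval_section_band convex_region2) (auto simp: region2_def)
    have f: "0 < F_quantile 2 (2 * m - 2) (q1 p)" "F_quantile 2 (2 * m - 2) (q1 p) < F_quantile 2 (2 * m - 2) (q2 p)"
      unfolding degrees_of_freedom(1) by (rule F_quantile_2_even q1_q2)+
    have f': "0 < ?f (q1 p)" "?f (q1 p) \<le> ?f (q2 p)" using f m by (auto intro!: divide_right_mono)
    have ratio: "inverse (1 + ?f (q1 p)) ^ Suc i - inverse (1 + ?f (q2 p)) ^ Suc i = q2 p - q1 p"
      unfolding degrees_of_freedom(1,3) by (intro F_quantile_2_even q1_q2)
    have J: "(\<integral>\<^sup>+w. ennreal (erlang_density (Suc i) 1 w) * indicator ?J (2 * w) \<partial>lborel) = ennreal (q2 p - q1 p)"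
      unfolding degrees_of_freedom(2) by (intro chi2_quantile_even q1_q2)
    have "(\<integral>\<^sup>+u. ennreal (exponential_density 1 u)
        * (\<integral>\<^sup>+v. ennreal (erlang_density i 1 v) * indicator ?A (u, v) \<partial>lborel) \<partial>lborel)
      = ennreal (q2 p - q1 p) * ennreal (q2 p - q1 p)"
      unfolding ind
      by (subst nn_integral_exponential_erlang_ratio[where h="\<lambda>w. indicator ?J (2 * w)", OF _ f'])
         (simp_all only: J ratio, measurable)
    also have "\<dots> = ennreal (1 - p)"
      using q1_q2 by (simp add: ennreal_mult[symmetric] power2_eq_square)
    finally show "(\<integral>\<^sup>+u. ennreal (exponential_density 1 u)
        * (\<integral>\<^sup>+v. ennreal (erlang_density i 1 v) * indicator ?A (u, v) \<partial>lborel) \<partial>lborel) = ennreal (1 - p)" .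
  qed (fact p)
qed

end

theorem theorem1:
  fixes n m :: nat and R :: "nat \<Rightarrow> nat" and p :: real
  assumes "1 < m" and "m \<le> n"
    and "(\<Sum>j\<in>{1..m}. R j) = n - m"
    and "0 < p" and "p < 1"
  shows
    "(\<forall>x. (\<forall>j\<in>{1..<m}. x j \<le> x (Suc j)) \<and> sighat m R x > 0 \<longrightarrow>
        band (C1 n m R p x) = {(t, y). 0 \<le> y \<and> y \<le> 1 \<and> U1 n m R p x t \<le> y \<and> y \<le> O1 n m R p x t}
      \<and> band (C2 n m R p x) = {(t, y). 0 \<le> y \<and> y \<le> 1 \<and> U2 n m R p x t \<le> y \<and> y \<le> O2 n m R p x t})
     \<and> exact_conf_band m R (\<lambda>x. band (C1 n m R p x)) p
     \<and> exact_conf_band m R (\<lambda>x. band (C2 n m R p x)) p"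
proof -
  \<comment> \<open>At least two observations means at least one spacing; \<open>m - 2\<close>
    serves as the Erlang index \<open>i\<close>.\<close>
  have m: "m = Suc (Suc (m - 2))" using assms by simp
  note hyps = m gam_1[OF assms(2,3)] assms(4,5)
  show ?thesis
    using band_C1[OF hyps] band_C2[OF hyps] exact_conf_band_C1[OF hyps] exact_conf_band_C2[OF hyps]
    by blast
qed

end
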